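(* Let $(X,d)$ be a metric space and let $\Phi:X\to\mathbb R\cup\{+\infty\}$ be a proper functional bounded from below. Assume that the local metric slope $|\nabla\Phi|:X\to\mathbb R\cup\{+\infty\}$ is an upper gradient of $\Phi$ and that $\mathcal M(|\nabla\Phi|)\neq\emptyset$. Let $u\in\mathcal M(|\nabla\Phi|)$ and $\varepsilon>0$ be such that $$\Phi(u)\le\inf_X\Phi+\varepsilon.$$ Then for any $\lambda>0$ there exist $\hat u\in\mathcal M(|\nabla\Phi|)$ and a neighborhood $\mathcal V$ of $\hat u$ such that (a) $d(u,\hat u)\le\lambda$; (b) $\Phi(\hat u)\le\Phi(u)$; (c) $\Phi(\hat u)<\Phi(v)+\frac{\varepsilon}{\lambda}d(v,\hat u)$ for all $v\in\mathcal V\setminus\{\hat u\}$.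
   Context: Notation: $\operatorname{dom}\Phi=\{u\in X:\Phi(u)<+\infty\}$; proper means $\operatorname{dom}\Phi\ne\emptyset$. The metric space is not assumed complete. Local metric slope: for $u\in\operatorname{dom}\Phi$, $|\nabla\Phi|(u):=\max\left\{\limsup_{v\to u}\frac{\Phi(u)-\Phi(v)}{d(u,v)},0\right\}$ (so it is $0$ at isolated points), and $|\nabla\Phi|(u):=+\infty$ for $u\notin\operatorname{dom}\Phi$. Locally absolutely continuous curve: a curve $v:(0,+\infty)\to X$ for which there is a nonnegative $m\in L^1_{\mathrm{loc}}(0,+\infty)$ with $d(v(t),v(s))\le\int_s^t m(r)\,dr$ for all $0<s\le t$. For such a curve the metric derivative $|\dot v|(t):=\lim_{h\to0}\frac{d(v(t+h),v(t))}{|h|}$ exists for a.e. $t$ and belongs to $L^1_{\mathrm{loc}}(0,+\infty)$. (Strong) upper gradient of $\Phi$: a nonnegative function $g:X\to\mathbb R\cup\{+\infty\}$ such that for every locally absolutely continuous curve $v:(0,+\infty)\to X$ with values in $\operatorname{dom}\Phi$, the function $g\circ v$ is Borel measurable and $|\Phi(v(t))-\Phi(v(s))|\le\int_s^t g(v(r))\,|\dot v|(r)\,dr$ for all $0<s\le t$ (the right-hand side may be $+\infty$). "Upper gradient" always means strong upper gradient. Gradient flow of $\Phi$ with respect to an upper gradient $g$: a locally absolutely continuous curve $v:(0,+\infty)\to X$ such that (1) $v(t)\in\operatorname{dom}\Phi$ for all $t>0$; (2) $\Phi(v(t))-\Phi(v(s))\le-\frac12\int_s^t|\dot v|(r)^2\,dr-\frac12\int_s^t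 g(v(r))^2\,dr$ for all $s,t\in(0,+\infty)$ (integrals are oriented). $\mathcal M(g)$ is the set of all $u\in\operatorname{dom}\Phi$ for which there exists a gradient flow $v:(0,+\infty)\to X$ of $\Phi$ with respect to $g$ with $\lim_{t\to0^+}v(t)=u$ and $\lim_{t\to0^+}\Phi(v(t))=\Phi(u)$. *)

theory Defs
  imports "HOL-Analysis.Analysis"
begin

text \<open>
  A functional with values in the reals extended by plus infinity is a function into
  \<^typ>\<open>ereal\<close> that never takes the value minus infinity. A curve defined on
  the positive half-line is a function on \<^typ>\<open>real\<close> of which only the values at
  positive arguments are ever used.
\<close>

definition effective_domain :: "('a \<Rightarrow> ereal) \<Rightarrow> 'a set" where
  "effective_domain \<Phi> = {u. \<Phi> u < \<infinity>}"

text \<open>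
  At an isolated point the filter \<^term>\<open>at u\<close> is trivial and the limsup is minus
  infinity, so the maximum is 0 there.
\<close>

definition local_slope :: "('a::metric_space \<Rightarrow> ereal) \<Rightarrow> 'a \<Rightarrow> ereal" where
  "local_slope \<Phi> u =
     (if u \<in> effective_domain \<Phi>
      then max (Limsup (at u) (\<lambda>v. (\<Phi> u - \<Phi> v) / ereal (dist u v))) 0
      else \<infinity>)"

definition loc_abs_continuous_curve :: "(real \<Rightarrow> 'a::metric_space) \<Rightarrow> bool" where
  "loc_abs_continuous_curve v \<longleftrightarrow>
     (\<exists>m :: real \<Rightarrow> real.
        (\<forall>r>0. 0 \<le> m r) \<and>
        (\<forall>s t. 0 < s \<and> s \<le> t \<longrightarrow> set_integrable lborel {s..t} m) \<and>
        (\<forall>s t. 0 < s \<and> s \<le> t \<longrightarrow> dist (v t) (v s) \<le> (LINT r:{s..t}|lborel. m r)))"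

text \<open>
  For a locally absolutely continuous curve this limit exists at almost every positive time;
  the unspecified values at the remaining times do not affect the integrals below.
\<close>

definition metric_derivative :: "(real \<Rightarrow> 'a::metric_space) \<Rightarrow> real \<Rightarrow> real" where
  "metric_derivative v t = Lim (at 0) (\<lambda>h. dist (v (t + h)) (v t) / \<bar>h\<bar>)"

text \<open>
  The product under the integral is taken in \<^typ>\<open>ennreal\<close>, so it is 0 as soon as
  one of the factors is 0.
\<close>

definition upper_gradient :: "('a::metric_space \<Rightarrow> ereal) \<Rightarrow> ('a \<Rightarrow> ereal) \<Rightarrow> bool" where
  "upper_gradient \<Phi> g \<longleftrightarrow>
     (\<forall>x. 0 \<le> g x) \<and>
     (\<forall>v :: real \<Rightarrow> 'a.
        loc_abs_continuous_curve v \<and> (\<forall>t>0. v t \<in> effective_domain \<Phi>) \<longrightarrow>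
          (\<lambda>r. g (v r)) \<in> borel_measurable (restrict_space borel {0<..}) \<and>
          (\<forall>s t. 0 < s \<and> s \<le> t \<longrightarrow>
             \<bar>\<Phi> (v t) - \<Phi> (v s)\<bar> \<le>
               enn2ereal (\<integral>\<^sup>+r\<in>{s..t}.
                 (e2ennreal (g (v r)) * ennreal (metric_derivative v r)) \<partial>lborel)))"

text \<open>
  Oriented integral of a nonnegative function, with values in the extended reals so that a
  divergent integral is infinite.
\<close>

definition oriented_nn_integral :: "real \<Rightarrow> real \<Rightarrow> (real \<Rightarrow> ennreal) \<Rightarrow> ereal" where
  "oriented_nn_integral s t f =
     (if s \<le> t then enn2ereal (\<integral>\<^sup>+r\<in>{s..t}. f r \<partial>lborel)
      else - enn2ereal (\<integral>\<^sup>+r\<in>{t..s}. f r \<partial>lborel))"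

text \<open>
  In the energy inequality the two integrals carry the same sign, so no difference of
  infinities occurs.
\<close>

definition gradient_flow ::
    "('a::metric_space \<Rightarrow> ereal) \<Rightarrow> ('a \<Rightarrow> ereal) \<Rightarrow> (real \<Rightarrow> 'a) \<Rightarrow> bool" where
  "gradient_flow \<Phi> g v \<longleftrightarrow>
     loc_abs_continuous_curve v \<and>
     (\<forall>t>0. v t \<in> effective_domain \<Phi>) \<and>
     (\<forall>s>0. \<forall>t>0.
        \<Phi> (v t) - \<Phi> (v s) \<le>
          - (ereal (1/2) * oriented_nn_integral s t (\<lambda>r. (ennreal (metric_derivative v r))\<^sup>2))
          - ereal (1/2) * oriented_nn_integral s t (\<lambda>r. (e2ennreal (g (v r)))\<^sup>2))"

definition flow_initial_points :: "('a::metric_space \<Rightarrow> ereal) \<Rightarrow> ('a \<Rightarrow> ereal) \<Rightarrow> 'a set" where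
  "flow_initial_points \<Phi> g =
     {u \<in> effective_domain \<Phi>.
        \<exists>v. gradient_flow \<Phi> g v \<and>
            (v \<longlongrightarrow> u) (at_right 0) \<and>
            ((\<lambda>t. \<Phi> (v t)) \<longlongrightarrow> \<Phi> u) (at_right 0)}"

end

theory Submission
  imports Defs
begin

text \<open>
  Put $k = \varepsilon / \lambda$ and let $v$ be a gradient flow issuing from $u$. Every point of $v$
  is again the starting point of a gradient flow, so it suffices to find one within distance
  $\lambda$ of $u$ at which the slope is strictly smaller than $k$; strictness turns the limsup in the
  slope into the local inequality (c). Suppose that the slope is at least $k$ as long as $v$ stays in
  the closed ball of radius $\lambda$ around $u$. The energy inequality and
  $2k|\dot v| \le |\dot v|^2 + |\nabla\Phi|^2(v)$ then give
  $\Phi(v(s)) - \Phi(v(t)) \ge k\, d(v(s), v(t))$ and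
  $2(\Phi(v(s)) - \Phi(v(t))) \ge k^2 (t - s)$. By the second inequality $v$ must leave the ball, as
  $\Phi$ is bounded below. At the first time $T$ with $d(u, v(T)) = \lambda$ the first inequality gives
  $\Phi(v(T)) \le \Phi(u) - \varepsilon \le \inf \Phi$, so $v(T)$ is a minimizer, where the slope is 0:
  a contradiction.

  The argument needs $d(v(s), v(t)) \le \int_s^t |\dot v|$, hence the almost everywhere existence of
  the metric derivative. Both are obtained from Vitali's covering theorem: the distance is bounded by
  the integral of the lower metric derivative, and differentiating that integral bounds the upper
  metric derivative by the lower one almost everywhere.
\<close>

section \<open>Differentiation of integrals\<close>

text \<open>The segment between \<open>x\<close> and \<open>y\<close> is the closed ball about its
  midpoint, so Vitali's theorem for balls applies; that theorem asks only that \<open>x\<close> lie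
  in the ball, not that it be the centre. Segments ending at \<open>x\<close> are the form in which
  difference quotients at \<open>x\<close> arise, and openness of \<open>U\<close> keeps the short
  ones inside \<open>U\<close>.\<close>

lemma Vitali_covering_segments:
  fixes S U :: "real set"
  assumes "open U" "S \<subseteq> U"
    and freq: "\<And>x. x \<in> S \<Longrightarrow> \<exists>\<^sub>F y in at x. P (closed_segment x y)"
  obtains \<C> where "countable \<C>" "disjoint \<C>"
    "\<forall>I\<in>\<C>. P I \<and> I \<subseteq> U \<and> (\<exists>a b. a < b \<and> I = {a..b})"
    "negligible (S - \<Union>\<C>)"
proof -
  define K where "K = {(x, y). x \<noteq> y \<and> P (closed_segment x y) \<and> closed_segment x y \<subseteq> U}"
  define a r where "a = (\<lambda>(x, y). (x + y) / 2 :: real)" and "r = (\<lambda>(x, y). \<bar>x - y\<bar> / 2 :: real)"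
  have cball: "cball (a (x, y)) (r (x, y)) = closed_segment x y" for x y
    by (auto simp: a_def r_def cball_eq_atLeastAtMost closed_segment_eq_real_ivl field_simps abs_if split: if_splits)
  have small: "\<exists>i. i \<in> K \<and> x \<in> cball (a i) (r i) \<and> r i < d" if "x \<in> S" "0 < d" for x d
  proof -
    have "x \<in> U" using that assms by auto
    then obtain e where e: "e > 0" "cball x e \<subseteq> U"
      using \<open>open U\<close> open_contains_cball by blast
    have "\<forall>\<^sub>F y in at x. y \<noteq> x \<and> dist y x < min e d"
      using e(1) that(2) unfolding eventually_at by (intro exI[of _ "min e d"]) auto
    then have "\<exists>\<^sub>F y in at x. P (closed_segment x y) \<and> y \<noteq> x \<and> dist y x < min e d"
      using freq[OF that(1)] frequently_eventually_frequently by fastforce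
    then obtain y where y: "P (closed_segment x y)" "y \<noteq> x" "dist y x < min e d"
      using frequently_ex by blast
    have "closed_segment x y \<subseteq> cball x e"
      using y e(1) by (intro closed_segment_subset) (auto simp: dist_commute)
    then have "(x, y) \<in> K" using y e by (auto simp: K_def)
    moreover have "x \<in> cball (a (x, y)) (r (x, y))" by (simp add: cball)
    moreover have "r (x, y) < d" using y that by (auto simp: r_def dist_real_def)
    ultimately show ?thesis by blast
  qed
  have pos: "0 < r i" if "i \<in> K" for i using that by (auto simp: K_def r_def)
  obtain C where C: "countable C" "C \<subseteq> K"
     "pairwise (\<lambda>i j. disjnt (cball (a i) (r i)) (cball (a j) (r j))) C"
     "negligible (S - (\<Union>i \<in> C. cball (a i) (r i)))"
    by (rule Vitali_covering_theorem_cballs[OF pos small])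
  show ?thesis
  proof (rule that[of "(\<lambda>i. cball (a i) (r i)) ` C"])
    show "countable ((\<lambda>i. cball (a i) (r i)) ` C)" using C by simp
    show "disjoint ((\<lambda>i. cball (a i) (r i)) ` C)"
      using C(3) unfolding pairwise_image disjnt_def by (rule pairwise_mono) auto
    show "negligible (S - \<Union> ((\<lambda>i. cball (a i) (r i)) ` C))" using C(4) by simp
    show "\<forall>I\<in>(\<lambda>i. cball (a i) (r i)) ` C. P I \<and> I \<subseteq> U \<and> (\<exists>a b. a < b \<and> I = {a..b})"
    proof
      fix I assume "I \<in> (\<lambda>i. cball (a i) (r i)) ` C"
      then obtain x y where xy: "(x, y) \<in> K" "I = closed_segment x y"
        using C(2) cball by auto
      then have "\<exists>a b. a < b \<and> I = {a..b}"
        unfolding closed_segment_eq_real_ivl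
        by (intro exI[of _ "min x y"] exI[of _ "max x y"]) (auto simp: K_def min_def max_def)
      then show "P I \<and> I \<subseteq> U \<and> (\<exists>a b. a < b \<and> I = {a..b})" using xy by (auto simp: K_def)
    qed
  qed
qed

text \<open>Countable additivity of both measures is written as integration over the counting
  measure of \<open>\<C>\<close>, so the comparison of single members integrates up.\<close>

lemma emeasure_Union_mono_scaled:
  assumes "countable \<C>" "disjoint \<C>" "\<C> \<subseteq> sets M" "\<C> \<subseteq> sets N"
    and le: "\<And>I. I \<in> \<C> \<Longrightarrow> c * emeasure M I \<le> d * emeasure N I"
  shows "c * emeasure M (\<Union>\<C>) \<le> d * emeasure N (\<Union>\<C>)"
proof -
  have disj: "disjoint_family_on (\<lambda>I. I) \<C>"
    using assms(2) by (auto simp: disjoint_def disjoint_family_on_def)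
  have eq: "emeasure L (\<Union>\<C>) = (\<integral>\<^sup>+I. emeasure L I \<partial>count_space \<C>)" if "\<C> \<subseteq> sets L" for L
    using emeasure_UN_countable[OF _ assms(1) disj, of L] that by auto
  show ?thesis
    unfolding eq[OF assms(3)] eq[OF assms(4)]
    by (subst (1 2) nn_integral_cmult[symmetric]) (auto intro!: nn_integral_mono le)
qed

text \<open>The sets treated below are cut out by filter conditions and come without measurability,
  so smallness is tested on a Borel set that covers them up to a negligible remainder.\<close>

lemma negligibleI_emeasure:
  fixes S :: "real set"
  assumes "\<And>e::real. e > 0 \<Longrightarrow> \<exists>W\<in>sets borel. negligible (S - W) \<and> emeasure lborel W \<le> ennreal e"
  shows "negligible S"
proof -
  have "\<exists>T. S \<subseteq> T \<and> T \<in> lmeasurable \<and> measure lebesgue T < e" if e: "e > 0" for e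
  proof -
    \<comment> \<open>Half of \<open>e\<close> is used because the outer criterion asks for a strict
      inequality.\<close>
    obtain W where W: "W \<in> sets borel" "negligible (S - W)" "emeasure lborel W \<le> ennreal (e / 2)"
      using assms[of "e / 2"] e by auto
    have Wl: "W \<in> lmeasurable"
      using W le_less_trans[OF W(3)] by (intro fmeasurableI) auto
    have *: "S - W \<in> lmeasurable" "measure lebesgue (S - W) = 0"
      using W(2) negligible_iff_measure by blast+
    have "measure lebesgue W \<le> e / 2"
      using enn2real_leI[OF _ W(3)] W(1) e by (simp add: measure_def)
    then have "measure lebesgue ((S - W) \<union> W) \<le> 0 + e / 2"
      using measure_Un_le[of "S - W" lebesgue W] Wl * by (auto simp: fmeasurableD)
    moreover have "(S - W) \<union> W \<in> lmeasurable" using *(1) Wl by (rule fmeasurable.Un)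
    ultimately show ?thesis using e by (intro exI[of _ "(S - W) \<union> W"]) auto
  qed
  then show ?thesis unfolding negligible_outer by blast
qed

text \<open>A finite Borel measure on the line is outer regular, and finiteness of the mass of
  \<open>A\<close> turns the bound on the mass of \<open>U\<close> into one on the excess
  \<open>U - A\<close>.\<close>

lemma outer_regular_density:
  fixes f :: "real \<Rightarrow> ennreal" and e :: real
  assumes [measurable]: "f \<in> borel_measurable borel" and fin: "(\<integral>\<^sup>+x. f x \<partial>lborel) < \<infinity>"
    and A: "A \<in> sets borel" and "e > 0"
  obtains U where "open U" "A \<subseteq> U" "emeasure (density lborel f) (U - A) < e"
proof -
  let ?M = "density lborel f"
  have fm: "emeasure ?M UNIV \<noteq> \<infinity>"
    using fin by (simp add: emeasure_density)
  then interpret finite_measure ?M by (intro finite_measureI) simp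
  have "emeasure ?M A = (INF U\<in>{U. A \<subseteq> U \<and> open U}. emeasure ?M U)"
    by (rule outer_regular) (use fm A in auto)
  moreover have "emeasure ?M A < emeasure ?M A + e"
    using emeasure_finite[of A] \<open>e > 0\<close> ennreal_add_left_cancel_less[of "emeasure ?M A" 0 e] by auto
  ultimately obtain U where U: "A \<subseteq> U" "open U" "emeasure ?M U < emeasure ?M A + e"
    by (auto simp: INF_less_iff)
  have "emeasure ?M A + emeasure ?M (U - A) = emeasure ?M (A \<union> (U - A))"
    using U A by (intro plus_emeasure) auto
  also have "A \<union> (U - A) = U" using U by auto
  finally have "emeasure ?M (U - A) < e"
    using U(3) by (metis ennreal_add_left_cancel_less)
  then show ?thesis using that U by blast
qed

lemma emeasure_lborel_closed_segment: "emeasure lborel (closed_segment x y) = ennreal \<bar>y - x\<bar>"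
  for x y :: real
  by (auto simp: closed_segment_eq_real_ivl)

section \<open>Almost everywhere bounds on the averages of a density over short segments\<close>

text \<open>Mass is compared on a Vitali cover \<open>W\<close> of the exceptional set: the chosen
  segments give \<open>W\<close> mass at least \<open>q\<close> times its length, whereas
  \<open>f < p\<close> on \<open>A\<close> limits it to \<open>p\<close> times its length plus the
  small mass of \<open>U - A\<close>. Since \<open>p < q\<close>, the length of \<open>W\<close> is
  small.\<close>

lemma negligible_upper_density:
  fixes f :: "real \<Rightarrow> ennreal" and p q :: real
  assumes [measurable]: "f \<in> borel_measurable borel" and fin: "(\<integral>\<^sup>+x. f x \<partial>lborel) < \<infinity>"
    and pq: "0 \<le> p" "p < q"
  shows "negligible {x. f x < p \<and>
    (\<exists>\<^sub>F y in at x. q * emeasure lborel (closed_segment x y) \<le> emeasure (density lborel f) (closed_segment x y))}"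
    (is "negligible ?E")
proof (rule negligibleI_emeasure)
  fix e :: real assume e: "e > 0"
  let ?\<nu> = "density lborel f"
  define A where "A = {x. f x < p}"
  have A[measurable]: "A \<in> sets borel" unfolding A_def by measurable
  \<comment> \<open>The slack carries the factor \<open>q - p\<close> that is cancelled in the final
    comparison.\<close>
  obtain U where U: "open U" "A \<subseteq> U" "emeasure ?\<nu> (U - A) < ennreal (e * (q - p))"
    using outer_regular_density[OF assms(1) fin A, of "e * (q - p)"] e pq by auto
  have [measurable]: "U \<in> sets borel" using U by simp
  have "?E \<subseteq> U" using U by (auto simp: A_def)
  then obtain \<C> where \<C>: "countable \<C>" "disjoint \<C>"
    "\<forall>I\<in>\<C>. q * emeasure lborel I \<le> emeasure ?\<nu> I \<and> I \<subseteq> U \<and> (\<exists>a b. a < b \<and> I = {a..b})"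
    "negligible (?E - \<Union>\<C>)"
    by (rule Vitali_covering_segments[OF U(1), of ?E "\<lambda>I. q * emeasure lborel I \<le> emeasure ?\<nu> I"]) auto
  have \<C>b: "\<C> \<subseteq> sets borel" using \<C>(3) by fastforce
  define W where "W = \<Union>\<C>"
  have W[measurable]: "W \<in> sets borel"
    unfolding W_def using \<C>(1) \<C>b by (rule sets.countable_Union)
  have WU: "W \<subseteq> U" using \<C>(3) by (auto simp: W_def)
  have "q * emeasure lborel W \<le> 1 * emeasure ?\<nu> W"
    unfolding W_def
    by (rule emeasure_Union_mono_scaled) (use \<C> \<C>b in auto)
  also have "emeasure ?\<nu> W = emeasure ?\<nu> (W \<inter> A) + emeasure ?\<nu> (W - A)"
    by (subst plus_emeasure) (auto intro!: arg_cong2[where f=emeasure])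
  also have "emeasure ?\<nu> (W - A) \<le> e * (q - p)"
    using U WU by (intro order.trans[OF emeasure_mono less_imp_le[OF U(3)]]) auto
  also have "emeasure ?\<nu> (W \<inter> A) \<le> (\<integral>\<^sup>+x. ennreal p * indicator W x \<partial>lborel)"
    by (simp add: emeasure_density)
      (intro nn_integral_mono, auto simp: A_def indicator_def less_imp_le split: if_splits)
  also have "\<dots> = p * emeasure lborel W" by (simp add: nn_integral_cmult_indicator)
  finally have 1: "q * emeasure lborel W \<le> p * emeasure lborel W + e * (q - p)"
    by (simp add: add_mono)
  \<comment> \<open>The same bound is read once more to see that \<open>W\<close> has finite length;
    only then can its multiple by \<open>p\<close> be subtracted.\<close>
  have "q * emeasure lborel W \<le> 1 * emeasure ?\<nu> W" by fact
  also have "\<dots> \<le> (\<integral>\<^sup>+x. f x \<partial>lborel)"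
    by (simp add: emeasure_density) (intro nn_integral_mono, auto simp: indicator_def)
  finally have "q * emeasure lborel W < \<infinity>" using fin by order
  then have "emeasure lborel W \<noteq> \<infinity>" using pq by (auto simp: ennreal_mult_less_top)
  then obtain w where w: "emeasure lborel W = ennreal w" "w \<ge> 0" by (cases "emeasure lborel W") auto
  have "q * w \<le> p * w + e * (q - p)"
    using 1 w pq e by (simp add: ennreal_mult[symmetric] ennreal_plus[symmetric] del: ennreal_plus)
  then have "(q - p) * w \<le> (q - p) * e" by (simp add: algebra_simps)
  then have "emeasure lborel W \<le> ennreal e" using pq e w by (simp add: mult_le_cancel_left)
  then show "\<exists>W\<in>sets borel. negligible (?E - W) \<and> emeasure lborel W \<le> ennreal e"
    using W \<C>(4) by (auto simp: W_def)
qed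

text \<open>The roles of mass and length are exchanged: the mass of \<open>W\<close> is at least
  \<open>q\<close> times the length of \<open>W \<inter> A\<close> and at most \<open>p\<close>
  times the length of \<open>W\<close>. The part \<open>W - A\<close> escapes the lower bound, so
  here the excess of \<open>U\<close> over \<open>A\<close> is made small in length.\<close>

lemma negligible_lower_density:
  fixes f :: "real \<Rightarrow> ennreal" and p q :: real
  assumes [measurable]: "f \<in> borel_measurable borel" and fin: "(\<integral>\<^sup>+x. f x \<partial>lborel) < \<infinity>"
    and pq: "0 \<le> p" "p < q"
  shows "negligible {x. f x > q \<and>
    (\<exists>\<^sub>F y in at x. emeasure (density lborel f) (closed_segment x y) \<le> p * emeasure lborel (closed_segment x y))}"
    (is "negligible ?E")
proof (rule negligibleI_emeasure)
  fix e :: real assume e: "e > 0"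
  let ?\<nu> = "density lborel f"
  define A where "A = {x. f x > q}"
  have A[measurable]: "A \<in> sets borel" unfolding A_def by measurable
  \<comment> \<open>Solves \<open>q * d = e * (q - p)\<close>, the slack with which the length of
    \<open>W\<close> comes out as at most \<open>e\<close>.\<close>
  define d where "d = e * (q - p) / q"
  have d: "d > 0" using e pq by (auto simp: d_def)
  obtain U where U: "open U" "A \<subseteq> U" "emeasure lborel (U - A) < ennreal d"
    using outer_regular_lborel[OF A d] by auto
  have [measurable]: "U \<in> sets borel" using U by simp
  have "?E \<subseteq> U" using U by (auto simp: A_def)
  then obtain \<C> where \<C>: "countable \<C>" "disjoint \<C>"
    "\<forall>I\<in>\<C>. emeasure ?\<nu> I \<le> p * emeasure lborel I \<and> I \<subseteq> U \<and> (\<exists>a b. a < b \<and> I = {a..b})"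
    "negligible (?E - \<Union>\<C>)"
    by (rule Vitali_covering_segments[OF U(1), of ?E "\<lambda>I. emeasure ?\<nu> I \<le> p * emeasure lborel I"]) auto
  have \<C>b: "\<C> \<subseteq> sets borel" using \<C>(3) by fastforce
  define W where "W = \<Union>\<C>"
  have W[measurable]: "W \<in> sets borel"
    unfolding W_def using \<C>(1) \<C>b by (rule sets.countable_Union)
  have WU: "W \<subseteq> U" using \<C>(3) by (auto simp: W_def)
  have A_fin: "q * emeasure lborel (X \<inter> A) \<le> emeasure ?\<nu> X" if [measurable]: "X \<in> sets borel" for X
  proof -
    have "q * emeasure lborel (X \<inter> A) = (\<integral>\<^sup>+x. ennreal q * indicator (X \<inter> A) x \<partial>lborel)"
      by (simp add: nn_integral_cmult_indicator)
    also have "\<dots> \<le> emeasure ?\<nu> X"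
      by (simp add: emeasure_density)
        (intro nn_integral_mono, auto simp: A_def indicator_def less_imp_le split: if_splits)
    finally show ?thesis .
  qed
  have split: "emeasure lborel W = emeasure lborel (W \<inter> A) + emeasure lborel (W - A)"
    by (subst plus_emeasure) (auto intro!: arg_cong2[where f=emeasure])
  have WA: "emeasure lborel (W - A) \<le> ennreal d"
    using U WU by (intro order.trans[OF emeasure_mono less_imp_le[OF U(3)]]) auto
  have "q * emeasure lborel (W \<inter> A) \<le> emeasure ?\<nu> W" by (rule A_fin) simp
  also have "\<dots> \<le> (\<integral>\<^sup>+x. f x \<partial>lborel)"
    by (simp add: emeasure_density) (intro nn_integral_mono, auto simp: indicator_def)
  finally have "q * emeasure lborel (W \<inter> A) < \<infinity>" using fin by order
  then have "emeasure lborel (W \<inter> A) \<noteq> \<infinity>" using pq by (auto simp: ennreal_mult_less_top)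
  then obtain x where x: "emeasure lborel (W \<inter> A) = ennreal x" "x \<ge> 0"
    by (cases "emeasure lborel (W \<inter> A)") auto
  obtain y where y: "emeasure lborel (W - A) = ennreal y" "y \<ge> 0" "y \<le> d"
    using WA d by (cases "emeasure lborel (W - A)") (auto simp: top_unique)
  have "q * emeasure lborel (W \<inter> A) \<le> emeasure ?\<nu> W" by (rule A_fin) simp
  also have "1 * emeasure ?\<nu> W \<le> p * emeasure lborel W"
    unfolding W_def
    by (rule emeasure_Union_mono_scaled) (use \<C> \<C>b in auto)
  finally have "q * x \<le> p * (x + y)"
    using x y pq by (simp add: split ennreal_mult[symmetric] ennreal_plus[symmetric] del: ennreal_plus)
  then have "q * (x + y) \<le> p * (x + y) + q * y" by (simp add: algebra_simps)
  also have "q * y \<le> q * d" using y pq by (intro mult_left_mono) auto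
  also have "q * d = e * (q - p)" using pq by (simp add: d_def)
  finally have "(q - p) * (x + y) \<le> (q - p) * e" by (simp add: algebra_simps)
  then have "x + y \<le> e" using pq by (simp add: mult_le_cancel_left)
  then have "emeasure lborel W \<le> ennreal e"
    using x y by (simp add: split ennreal_plus[symmetric] del: ennreal_plus)
  then show "\<exists>W\<in>sets borel. negligible (?E - W) \<and> emeasure lborel W \<le> ennreal e"
    using W \<C>(4) by (auto simp: W_def)
qed

lemma AE_not_in_negligible:
  assumes "negligible S" shows "AE x in lborel. x \<notin> S"
  using assms AE_not_in[of S lebesgue] AE_completion_iff[of "\<lambda>x. x \<notin> S" lborel]
  by (auto simp: negligible_iff_null_sets)

text \<open>The two rationals index one of countably many null sets from the density lemmas; the gap
  between them is what those lemmas require.\<close>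

lemma ennreal_rat_between:
  fixes q :: real and x :: ennreal
  assumes "x < ennreal q"
  obtains p r :: rat where "0 \<le> p" "p < r" "x < ennreal (of_rat p)" "of_rat r < q"
proof -
  obtain x' where x': "x = ennreal x'" "x' \<ge> 0"
    using assms by (cases x) auto
  with assms have "x' < q" by (simp add: ennreal_less_iff)
  then obtain p where p: "x' < of_rat p" "of_rat p < q" using of_rat_dense by blast
  then obtain r where r: "of_rat p < (of_rat r :: real)" "of_rat r < q" using of_rat_dense by blast
  have "0 \<le> (of_rat p :: real)" using p(1) x'(2) by linarith
  with p r x' that[of p r] show thesis by (simp add: of_rat_less ennreal_less_iff)
qed

text \<open>The exceptional sets of all rational pairs are discarded together; any real
  \<open>q\<close> above \<open>f x\<close> leaves room for such a pair.\<close>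

lemma AE_upper_density:
  fixes f :: "real \<Rightarrow> ennreal"
  assumes "f \<in> borel_measurable borel" and "(\<integral>\<^sup>+x. f x \<partial>lborel) < \<infinity>"
  shows "AE x in lborel. \<forall>q::real. f x < q \<longrightarrow>
    (\<forall>\<^sub>F y in at x. emeasure (density lborel f) (closed_segment x y) \<le> q * ennreal \<bar>y - x\<bar>)"
proof -
  let ?N = "\<lambda>p q. {x. f x < ennreal p \<and> (\<exists>\<^sub>F y in at x.
    ennreal q * emeasure lborel (closed_segment x y) \<le> emeasure (density lborel f) (closed_segment x y))}"
  have "AE x in lborel. \<forall>p q :: rat. 0 \<le> p \<longrightarrow> p < q \<longrightarrow> x \<notin> ?N (of_rat p) (of_rat q)"
    unfolding AE_all_countable
    using AE_not_in_negligible[OF negligible_upper_density[OF assms]] by (auto simp: of_rat_less)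
  then show ?thesis
  proof (eventually_elim, intro allI impI)
    fix x and q :: real
    assume *: "\<forall>p q :: rat. 0 \<le> p \<longrightarrow> p < q \<longrightarrow> x \<notin> ?N (of_rat p) (of_rat q)" and "f x < ennreal q"
    then obtain p r :: rat where pr: "0 \<le> p" "p < r" "f x < ennreal (of_rat p)" "of_rat r < q"
      using ennreal_rat_between by blast
    with * have "\<not> (\<exists>\<^sub>F y in at x. ennreal (of_rat r) * ennreal \<bar>y - x\<bar>
        \<le> emeasure (density lborel f) (closed_segment x y))"
      by (auto simp: emeasure_lborel_closed_segment)
    then have "\<forall>\<^sub>F y in at x. emeasure (density lborel f) (closed_segment x y) < ennreal (of_rat r) * ennreal \<bar>y - x\<bar>"
      by (simp add: frequently_def not_le)
    then show "\<forall>\<^sub>F y in at x. emeasure (density lborel f) (closed_segment x y) \<le> ennreal q * ennreal \<bar>y - x\<bar>"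
    proof eventually_elim
      case (elim y)
      also have "ennreal (of_rat r) * ennreal \<bar>y - x\<bar> \<le> ennreal q * ennreal \<bar>y - x\<bar>"
        using pr by (intro mult_right_mono ennreal_leI) auto
      finally show ?case by simp
    qed
  qed
qed

text \<open>Again countably many null sets are discarded, now with a rational pair squeezed between
  \<open>p\<close> and \<open>f x\<close>.\<close>

lemma AE_lower_density:
  fixes f :: "real \<Rightarrow> ennreal"
  assumes "f \<in> borel_measurable borel" and "(\<integral>\<^sup>+x. f x \<partial>lborel) < \<infinity>"
  shows "AE x in lborel. \<forall>p::real. ennreal p < f x \<longrightarrow>
    (\<forall>\<^sub>F y in at x. p * ennreal \<bar>y - x\<bar> \<le> emeasure (density lborel f) (closed_segment x y))"
proof -
  let ?N = "\<lambda>p q. {x. f x > ennreal q \<and> (\<exists>\<^sub>F y in at x.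
    emeasure (density lborel f) (closed_segment x y) \<le> ennreal p * emeasure lborel (closed_segment x y))}"
  have "AE x in lborel. \<forall>p q :: rat. 0 \<le> p \<longrightarrow> p < q \<longrightarrow> x \<notin> ?N (of_rat p) (of_rat q)"
    unfolding AE_all_countable
    using AE_not_in_negligible[OF negligible_lower_density[OF assms]] by (auto simp: of_rat_less)
  then show ?thesis
  proof (eventually_elim, intro allI impI)
    fix x and p :: real
    assume *: "\<forall>p q :: rat. 0 \<le> p \<longrightarrow> p < q \<longrightarrow> x \<notin> ?N (of_rat p) (of_rat q)" and px: "ennreal p < f x"
    show "\<forall>\<^sub>F y in at x. ennreal p * ennreal \<bar>y - x\<bar> \<le> emeasure (density lborel f) (closed_segment x y)"
    proof (cases "p \<le> 0")
      case True
      then show ?thesis by (simp add: ennreal_neg)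
    next
      case False
      \<comment> \<open>Since \<open>f x\<close> may be infinite, a finite value below it is fixed
        before rationals are chosen.\<close>
      obtain z where z: "ennreal p < z" "z < f x" using dense[OF px] by blast
      then obtain z' where z': "z = ennreal z'" "z' \<ge> 0"
        using less_trans[OF z(2), of top] by (cases z) (auto simp: top_unique)
      have "p < z'" using z z' False by (simp add: ennreal_less_iff)
      then obtain a where a: "p < of_rat a" "of_rat a < z'" using of_rat_dense by blast
      then obtain b where b: "of_rat a < (of_rat b :: real)" "of_rat b < z'" using of_rat_dense by blast
      have a0: "0 \<le> (of_rat a :: real)" using a False by linarith
      have "ennreal (of_rat b) < z" unfolding z'(1) by (rule ennreal_lessI) (use b a0 in linarith)+
      then have fb: "ennreal (of_rat b) < f x" using z(2) by order
      have "0 \<le> a" "a < b" using a0 b by (simp_all add: of_rat_less)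
      with * fb have "\<not> (\<exists>\<^sub>F y in at x. 
          emeasure (density lborel f) (closed_segment x y) \<le> ennreal (of_rat a) * ennreal \<bar>y - x\<bar>)"
        by (auto simp: emeasure_lborel_closed_segment)
      then have "\<forall>\<^sub>F y in at x. ennreal (of_rat a) * ennreal \<bar>y - x\<bar> < emeasure (density lborel f) (closed_segment x y)"
        by (simp add: frequently_def not_le)
      then show ?thesis
      proof eventually_elim
        case (elim y)
        have "ennreal p * ennreal \<bar>y - x\<bar> \<le> ennreal (of_rat a) * ennreal \<bar>y - x\<bar>"
          using a by (intro mult_right_mono ennreal_leI) auto
        with elim show ?case by order
      qed
    qed
  qed
qed

section \<open>The metric derivative\<close>

text \<open>Induction splits off the rightmost interval \<open>{a..b}\<close>, found by ranking the
  family by \<open>Inf\<close>. The others end before \<open>a\<close>, so the hypothesis is applied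
  with right end \<open>a\<close>; the interval contributes its own displacement and
  \<open>{b<..<t}\<close> is a new gap. Open intervals in the assumption make these gaps disjoint
  from the closed intervals.\<close>

lemma dist_le_sum_plus_gaps:
  fixes v :: "real \<Rightarrow> 'a::metric_space" and m :: "real \<Rightarrow> ennreal"
  assumes [measurable]: "m \<in> borel_measurable borel"
    and le: "\<And>s t. s \<le> t \<Longrightarrow> ennreal (dist (v s) (v t)) \<le> emeasure (density lborel m) {s<..<t}"
    and "finite \<F>" "disjoint \<F>" "s \<le> t"
    and "\<And>I. I \<in> \<F> \<Longrightarrow> I \<subseteq> {s..t} \<and> (\<exists>a b. a < b \<and> I = {a..b})"
  shows "ennreal (dist (v s) (v t)) \<le>
    (\<Sum>I\<in>\<F>. ennreal (dist (v (Inf I)) (v (Sup I)))) + emeasure (density lborel m) ({s<..<t} - \<Union>\<F>)"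
  using assms(3-)
proof (induction \<F> arbitrary: t rule: finite_ranking_induct[where f=Inf])
  case empty
  then show ?case using le[of s t] by simp
next
  case (insert I \<F>)
  let ?\<mu> = "density lborel m"
  show ?case
  \<comment> \<open>The ranking induction does not exclude that the inserted interval is already
    present.\<close>
  proof (cases "I \<in> \<F>")
    case True
    then have *: "insert I \<F> = \<F>" by blast
    show ?thesis using insert.prems unfolding * by (rule insert.IH)
  next
    case False
    obtain a b where ab: "a < b" "I = {a..b}" using insert.prems(3)[of I] by auto
    have st: "s \<le> a" "b \<le> t" using insert.prems(3)[of I] ab by auto
    \<comment> \<open>An interval that starts no later than \<open>a\<close> and misses
      \<open>a\<close> must end before \<open>a\<close>.\<close>
    have left: "J \<subseteq> {s..a} \<and> (\<exists>a b. a < b \<and> J = {a..b})" if "J \<in> \<F>" for J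
    proof -
      have J: "J \<subseteq> {s..t}" "\<exists>a b. a < b \<and> J = {a..b}" using insert.prems(3)[of J] that by simp_all
      obtain c d where cd: "c < d" "J = {c..d}" using J(2) by blast
      have "s \<le> c" using J(1) cd by simp
      have "c \<le> a" using insert.hyps(2)[OF that] ab cd by simp
      moreover have "a \<notin> J"
      proof -
        have "J \<inter> I = {}"
          by (rule disjointD[OF insert.prems(1)]) (use that False in auto)
        moreover have "a \<in> I" using ab by simp
        ultimately show ?thesis by blast
      qed
      ultimately have "d < a" using cd by simp
      with \<open>s \<le> c\<close> have "J \<subseteq> {s..a}" using cd by simp
      with J(2) show ?thesis by blast
    qed
    have IH: "ennreal (dist (v s) (v a)) \<le>
      (\<Sum>I\<in>\<F>. ennreal (dist (v (Inf I)) (v (Sup I)))) + emeasure ?\<mu> ({s<..<a} - \<Union>\<F>)"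
      by (rule insert.IH[OF _ st(1) left]) (use insert.prems(1) pairwise_subset in blast)
    have meas [measurable]: "\<Union>\<F> \<in> sets borel"
      using left by (intro sets.finite_Union insert.hyps) fastforce
    have sub: "({s<..<a} - \<Union>\<F>) \<union> {b<..<t} \<subseteq> {s<..<t} - \<Union>(insert I \<F>)"
    proof -
      have "x \<le> a" if "x \<in> \<Union>\<F>" for x using left that by fastforce
      then have "{b<..<t} \<inter> \<Union>\<F> = {}" using ab(1) by fastforce
      moreover have "{s<..<a} \<inter> I = {}" "{b<..<t} \<inter> I = {}" using ab by auto
      moreover have "{s<..<a} \<subseteq> {s<..<t}" "{b<..<t} \<subseteq> {s<..<t}" using ab(1) st by auto
      ultimately show ?thesis by blast
    qed
    define \<sigma> where "\<sigma> = (\<Sum>I\<in>\<F>. ennreal (dist (v (Inf I)) (v (Sup I))))"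
    have "emeasure ?\<mu> ({s<..<a} - \<Union>\<F>) + emeasure ?\<mu> {b<..<t} = emeasure ?\<mu> (({s<..<a} - \<Union>\<F>) \<union> {b<..<t})"
      by (rule plus_emeasure) (use ab(1) in auto)
    also have "\<dots> \<le> emeasure ?\<mu> ({s<..<t} - \<Union>(insert I \<F>))"
      by (rule emeasure_mono[OF sub]) (simp add: ab(2))
    finally have \<mu>: "emeasure ?\<mu> ({s<..<a} - \<Union>\<F>) + emeasure ?\<mu> {b<..<t}
      \<le> emeasure ?\<mu> ({s<..<t} - \<Union>(insert I \<F>))" .
    have "ennreal (dist (v s) (v t)) \<le> ennreal (dist (v s) (v a) + (dist (v a) (v b) + dist (v b) (v t)))"
      using dist_triangle[of "v s" "v t" "v a"] dist_triangle[of "v a" "v t" "v b"]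
      by (intro ennreal_leI) linarith
    also have "\<dots> = ennreal (dist (v a) (v b)) + (ennreal (dist (v s) (v a)) + ennreal (dist (v b) (v t)))"
      by (simp add: ennreal_plus[symmetric] del: ennreal_plus)
    also have "\<dots> \<le> ennreal (dist (v a) (v b)) + ((\<sigma> + emeasure ?\<mu> ({s<..<a} - \<Union>\<F>)) + emeasure ?\<mu> {b<..<t})"
      using st by (intro add_mono order.refl IH[folded \<sigma>_def] le)
    also have "\<dots> = (ennreal (dist (v a) (v b)) + \<sigma>) + (emeasure ?\<mu> ({s<..<a} - \<Union>\<F>) + emeasure ?\<mu> {b<..<t})"
      by (simp only: add.assoc)
    also have "\<dots> \<le> (ennreal (dist (v a) (v b)) + \<sigma>) + emeasure ?\<mu> ({s<..<t} - \<Union>(insert I \<F>))"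
      by (rule add_left_mono[OF \<mu>])
    also have "ennreal (dist (v a) (v b)) + \<sigma> = (\<Sum>I\<in>insert I \<F>. ennreal (dist (v (Inf I)) (v (Sup I))))"
      using False insert.hyps ab by (simp add: \<sigma>_def del: sum_ennreal)
    finally show ?thesis .
  qed
qed

text \<open>
  The lower metric derivative as an explicit supremum of infima: over each fixed range of
  increments the infimum is upper semicontinuous in \<^term>\<open>x\<close>, which makes it Borel.
\<close>

definition lower_speed :: "(real \<Rightarrow> 'a::metric_space) \<Rightarrow> real \<Rightarrow> ennreal" where
  "lower_speed v x =
     (SUP n. INF h\<in>{h. h \<noteq> 0 \<and> \<bar>h\<bar> < 1 / Suc n}. ennreal (dist (v (x + h)) (v x) / \<bar>h\<bar>))"

lemma borel_measurable_lower_speed: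
  assumes "continuous_on UNIV v"
  shows "lower_speed v \<in> borel_measurable borel"
proof -
  have "(\<lambda>x. INF h\<in>{h. h \<noteq> 0 \<and> \<bar>h\<bar> < 1 / Suc n}. ennreal (dist (v (x + h)) (v x) / \<bar>h\<bar>))
    \<in> borel_measurable borel" for n
  proof (rule borel_measurableI_less)
    fix c :: ennreal
    have "open {x. ennreal (dist (v (x + h)) (v x) / \<bar>h\<bar>) < c}" for h
    proof (rule open_Collect_less)
      have "continuous_on UNIV (\<lambda>x. v (x + h))"
        by (rule continuous_on_compose2[OF assms]) (auto intro: continuous_intros)
      then show "continuous_on UNIV (\<lambda>x. ennreal (dist (v (x + h)) (v x) / \<bar>h\<bar>))"
        unfolding divide_inverse
        by (intro continuous_on_ennreal continuous_on_mult continuous_on_dist assms continuous_on_const)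
    qed simp
    then have "open (\<Union>h\<in>{h. h \<noteq> 0 \<and> \<bar>h\<bar> < 1 / Suc n}. {x. ennreal (dist (v (x + h)) (v x) / \<bar>h\<bar>) < c})"
      by blast
    moreover have "{x\<in>space borel. (INF h\<in>{h. h \<noteq> 0 \<and> \<bar>h\<bar> < 1 / Suc n}. ennreal (dist (v (x + h)) (v x) / \<bar>h\<bar>)) < c}
      = (\<Union>h\<in>{h. h \<noteq> 0 \<and> \<bar>h\<bar> < 1 / Suc n}. {x. ennreal (dist (v (x + h)) (v x) / \<bar>h\<bar>) < c})"
      unfolding INF_less_iff by auto
    ultimately show "{x\<in>space borel. (INF h\<in>{h. h \<noteq> 0 \<and> \<bar>h\<bar> < 1 / Suc n}. ennreal (dist (v (x + h)) (v x) / \<bar>h\<bar>)) < c} \<in> sets borel"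
      by simp
  qed
  then show ?thesis
    unfolding lower_speed_def[abs_def] by (intro borel_measurable_SUP) auto
qed

text \<open>Together with \<open>lower_speed_lessD\<close> this says in filter form that
  \<open>lower_speed\<close> is the liminf of the difference quotients: values below it are exceeded
  eventually, values above it are undercut frequently.\<close>

lemma less_lower_speedD:
  assumes "c < lower_speed v x"
  shows "\<forall>\<^sub>F y in at x. c < ennreal (dist (v y) (v x) / \<bar>y - x\<bar>)"
proof -
  obtain n where n: "c < (INF h\<in>{h. h \<noteq> 0 \<and> \<bar>h\<bar> < 1 / Suc n}. ennreal (dist (v (x + h)) (v x) / \<bar>h\<bar>))"
    using assms unfolding lower_speed_def less_SUP_iff by blast
  have "c < ennreal (dist (v y) (v x) / \<bar>y - x\<bar>)" if "y \<noteq> x" "dist y x < 1 / Suc n" for y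
    using less_INF_D[OF n, of "y - x"] that by (auto simp: dist_real_def)
  then show ?thesis unfolding eventually_at by (intro exI[of _ "1 / Suc n"]) simp
qed

lemma lower_speed_lessD:
  assumes "lower_speed v x < c"
  shows "\<exists>\<^sub>F y in at x. ennreal (dist (v y) (v x) / \<bar>y - x\<bar>) < c"
  unfolding frequently_at
proof (intro allI impI)
  fix d :: real assume "d > 0"
  then obtain n where n: "1 / Suc n < d" using nat_approx_posE by (metis inverse_eq_divide)
  have "(INF h\<in>{h. h \<noteq> 0 \<and> \<bar>h\<bar> < 1 / Suc n}. ennreal (dist (v (x + h)) (v x) / \<bar>h\<bar>)) \<le> lower_speed v x"
    unfolding lower_speed_def by (intro SUP_upper) auto
  then have "(INF h\<in>{h. h \<noteq> 0 \<and> \<bar>h\<bar> < 1 / Suc n}. ennreal (dist (v (x + h)) (v x) / \<bar>h\<bar>)) < c"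
    using assms by order
  then obtain h where "h \<noteq> 0" "\<bar>h\<bar> < 1 / Suc n" "ennreal (dist (v (x + h)) (v x) / \<bar>h\<bar>) < c"
    unfolding INF_less_iff by auto
  then show "\<exists>y\<in>UNIV. y \<noteq> x \<and> dist y x < d \<and> ennreal (dist (v y) (v x) / \<bar>y - x\<bar>) < c"
    using n by (intro bexI[of _ "x + h"]) (auto simp: dist_real_def)
qed

section \<open>Difference quotients compared with integrals\<close>

text \<open>The upper density bound divided by the length of the segment. It is used twice: with a
  given majorant \<open>m\<close>, and later with \<open>lower_speed\<close> itself, where it bounds
  the limsup of the quotients by their liminf.\<close>

lemma AE_difference_quotient_le:
  fixes m :: "real \<Rightarrow> ennreal" and v :: "real \<Rightarrow> 'a::metric_space"
  assumes "m \<in> borel_measurable borel" and "(\<integral>\<^sup>+x. m x \<partial>lborel) < \<infinity>"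
    and le: "\<And>s t. s \<le> t \<Longrightarrow> ennreal (dist (v s) (v t)) \<le> emeasure (density lborel m) {s..t}"
  shows "AE x in lborel. \<forall>q::real. m x < q \<longrightarrow> (\<forall>\<^sub>F y in at x. dist (v y) (v x) / \<bar>y - x\<bar> \<le> q)"
  using AE_upper_density[OF assms(1,2)]
proof (eventually_elim, intro allI impI)
  fix x and q :: real
  assume "\<forall>q::real. m x < q \<longrightarrow>
    (\<forall>\<^sub>F y in at x. emeasure (density lborel m) (closed_segment x y) \<le> q * ennreal \<bar>y - x\<bar>)" and q: "m x < q"
  then have "\<forall>\<^sub>F y in at x. emeasure (density lborel m) (closed_segment x y) \<le> q * ennreal \<bar>y - x\<bar>"
    by blast
  moreover have "\<forall>\<^sub>F y in at x. y \<noteq> x" by (simp add: eventually_neq_at_within)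
  ultimately show "\<forall>\<^sub>F y in at x. dist (v y) (v x) / \<bar>y - x\<bar> \<le> q"
  proof eventually_elim
    case (elim y)
    have q0: "q > 0" using q by (metis ennreal_eq_0_iff not_less not_less_zero)
    have "ennreal (dist (v y) (v x)) \<le> emeasure (density lborel m) (closed_segment x y)"
      using le[of x y] le[of y x] by (auto simp: closed_segment_eq_real_ivl dist_commute)
    also have "\<dots> \<le> q * ennreal \<bar>y - x\<bar>" by (rule elim)
    also have "\<dots> = ennreal (q * \<bar>y - x\<bar>)" using q0 by (simp add: ennreal_mult)
    finally have "dist (v y) (v x) \<le> q * \<bar>y - x\<bar>" using q0 by (subst (asm) ennreal_le_iff) auto
    then show ?case using elim(2) by (simp add: divide_le_eq)
  qed
qed

text \<open>A value \<open>q\<close> strictly between \<open>m x\<close> and the lower speed would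
  eventually be both an upper bound of the quotients and strictly below them. This makes the lower
  speed integrable.\<close>

lemma lower_speed_AE_le:
  fixes m :: "real \<Rightarrow> ennreal" and v :: "real \<Rightarrow> 'a::metric_space"
  assumes "m \<in> borel_measurable borel" and "(\<integral>\<^sup>+x. m x \<partial>lborel) < \<infinity>"
    and le: "\<And>s t. s \<le> t \<Longrightarrow> ennreal (dist (v s) (v t)) \<le> emeasure (density lborel m) {s..t}"
  shows "AE x in lborel. lower_speed v x \<le> m x"
proof -
  have "AE x in lborel. \<forall>q::real. m x < q \<longrightarrow> (\<forall>\<^sub>F y in at x. dist (v y) (v x) / \<bar>y - x\<bar> \<le> q)"
    by (rule AE_difference_quotient_le) (use assms in auto)
  then show ?thesis
  proof eventually_elim
    case (elim x)
    show ?case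
    proof (rule ccontr)
      assume "\<not> lower_speed v x \<le> m x"
      then obtain q where q: "m x < q" "q < lower_speed v x"
        using dense[of "m x" "lower_speed v x"] by (auto simp: not_le)
      then obtain q' where q': "q = ennreal q'" "0 \<le> q'" by (cases q) (auto simp: top_unique)
      have "\<forall>\<^sub>F y in at x. dist (v y) (v x) / \<bar>y - x\<bar> \<le> q'" using elim q q' by auto
      moreover have "\<forall>\<^sub>F y in at x. q < ennreal (dist (v y) (v x) / \<bar>y - x\<bar>)"
        by (rule less_lower_speedD[OF q(2)])
      ultimately have "\<forall>\<^sub>F y in at x. False"
        by eventually_elim (use q' in \<open>auto simp: ennreal_less_iff\<close>)
      then show False by simp
    qed
  qed
qed

text \<open>As \<open>ennreal\<close> truncates negative numbers to 0, only subadditivity survives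
  when \<open>a\<close> may be negative; it is applied with a product containing
  \<open>n - \<eta>\<close>.\<close>

lemma ennreal_add_le: "0 \<le> b \<Longrightarrow> ennreal (a + b) \<le> ennreal a + ennreal b"
  by (cases "a \<ge> 0") (auto simp: ennreal_neg intro!: ennreal_leI)

text \<open>With \<open>n\<close> the lower speed at \<open>x\<close>, the quotient is frequently
  below \<open>n + \<eta>\<close>, while the integral over the segment is eventually at least
  \<open>n - \<eta>\<close> times its length. The two errors add up to
  \<open>2 * \<eta>\<close>.\<close>

lemma frequently_dist_le_lower_speed:
  fixes v :: "real \<Rightarrow> 'a::metric_space" and \<eta> :: real
  assumes fin: "lower_speed v x < \<infinity>" and \<eta>: "\<eta> > 0"
    and lower: "\<forall>p::real. ennreal p < lower_speed v x \<longrightarrow>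
      (\<forall>\<^sub>F y in at x. p * ennreal \<bar>y - x\<bar> \<le> emeasure (density lborel (lower_speed v)) (closed_segment x y))"
  shows "\<exists>\<^sub>F y in at x. ennreal (dist (v x) (v y)) \<le>
    emeasure (density lborel (lower_speed v)) (closed_segment x y) + ennreal (2 * \<eta>) * ennreal \<bar>y - x\<bar>"
proof -
  obtain n where n: "lower_speed v x = ennreal n" "n \<ge> 0"
    using fin by (cases "lower_speed v x") auto
  have "lower_speed v x < ennreal (n + \<eta>)" using n \<eta> by (simp add: ennreal_less_iff)
  then have freq: "\<exists>\<^sub>F y in at x. ennreal (dist (v y) (v x) / \<bar>y - x\<bar>) < ennreal (n + \<eta>)"
    by (rule lower_speed_lessD)
  have "\<forall>\<^sub>F y in at x. ennreal (n - \<eta>) * ennreal \<bar>y - x\<bar> \<le> emeasure (density lborel (lower_speed v)) (closed_segment x y)"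
  proof (cases "n - \<eta> < 0")
    case True
    then show ?thesis by (simp add: ennreal_neg)
  next
    case False
    then have "ennreal (n - \<eta>) < lower_speed v x" using n \<eta> by (simp add: ennreal_less_iff)
    then show ?thesis using lower by blast
  qed
  moreover have "\<forall>\<^sub>F y in at x. y \<noteq> x" by (simp add: eventually_neq_at_within)
  ultimately have ev: "\<forall>\<^sub>F y in at x. ennreal (n - \<eta>) * ennreal \<bar>y - x\<bar> \<le>
    emeasure (density lborel (lower_speed v)) (closed_segment x y) \<and> y \<noteq> x" by eventually_elim auto
  show ?thesis
    using frequently_eventually_frequently[OF freq ev]
  proof (rule frequently_elim1)
    fix y
    assume y: "ennreal (dist (v y) (v x) / \<bar>y - x\<bar>) < ennreal (n + \<eta>) \<and>
      ennreal (n - \<eta>) * ennreal \<bar>y - x\<bar> \<le> emeasure (density lborel (lower_speed v)) (closed_segment x y) \<and> y \<noteq> x"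
    then have "dist (v y) (v x) / \<bar>y - x\<bar> < n + \<eta>" by (subst (asm) ennreal_less_iff) auto
    then have "dist (v x) (v y) \<le> (n - \<eta>) * \<bar>y - x\<bar> + 2 * \<eta> * \<bar>y - x\<bar>"
      using y by (simp add: divide_less_eq dist_commute algebra_simps)
    then have "ennreal (dist (v x) (v y)) \<le> ennreal ((n - \<eta>) * \<bar>y - x\<bar> + 2 * \<eta> * \<bar>y - x\<bar>)"
      by (rule ennreal_leI)
    also have "\<dots> \<le> ennreal ((n - \<eta>) * \<bar>y - x\<bar>) + ennreal (2 * \<eta> * \<bar>y - x\<bar>)"
      using \<eta> by (intro ennreal_add_le) auto
    also have "\<dots> = ennreal (n - \<eta>) * ennreal \<bar>y - x\<bar> + ennreal (2 * \<eta>) * ennreal \<bar>y - x\<bar>"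
      using \<eta> by (subst (1 2) ennreal_mult'') auto
    also have "\<dots> \<le> emeasure (density lborel (lower_speed v)) (closed_segment x y) + ennreal (2 * \<eta>) * ennreal \<bar>y - x\<bar>"
      using y by (intro add_right_mono) auto
    finally show "ennreal (dist (v x) (v y)) \<le>
      emeasure (density lborel (lower_speed v)) (closed_segment x y) + ennreal (2 * \<eta>) * ennreal \<bar>y - x\<bar>" .
  qed
qed

text \<open>Continuity from above: the remainders after finitely many members decrease to a null set
  inside a set of finite measure.\<close>

lemma countable_Union_finite_remainder:
  assumes "countable \<C>" "\<C> \<subseteq> sets M" and A: "A \<in> sets M" "emeasure M A < \<infinity>"
    and null: "emeasure M (A - \<Union>\<C>) = 0" and e: "0 < (e::ennreal)"
  obtains \<F> where "finite \<F>" "\<F> \<subseteq> \<C>" "emeasure M (A - \<Union>\<F>) < e"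
proof -
  \<comment> \<open>Members of index at most \<open>n\<close> in an injective enumeration; this
    covers finite and infinite \<open>\<C>\<close> alike.\<close>
  define F where "F n = {I \<in> \<C>. to_nat_on \<C> I \<le> n}" for n
  have fin: "finite (F n)" for n
    unfolding F_def
    by (rule inj_on_finite[where f="to_nat_on \<C>" and B="{..n}"])
      (auto intro: inj_on_subset[OF inj_on_to_nat_on[OF assms(1)]])
  have sub: "F n \<subseteq> \<C>" for n by (auto simp: F_def)
  have meas: "A - \<Union>(F n) \<in> sets M" for n
    using A sub[of n] assms(2) fin[of n] by (intro sets.Diff sets.finite_Union) auto
  have "(\<lambda>n. emeasure M (A - \<Union>(F n))) \<longlonglongrightarrow> emeasure M (\<Inter>n. A - \<Union>(F n))"
  proof (rule Lim_emeasure_decseq)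
    show "decseq (\<lambda>n. A - \<Union>(F n))" by (rule decseq_SucI) (auto simp: F_def)
    show "emeasure M (A - \<Union>(F n)) \<noteq> \<infinity>" for n
      using emeasure_mono[of "A - \<Union>(F n)" A M] A by (auto simp: top_unique)
  qed (use meas in auto)
  also have "(\<Inter>n. A - \<Union>(F n)) = A - \<Union>\<C>" by (auto simp: F_def)
  finally have "\<forall>\<^sub>F n in sequentially. emeasure M (A - \<Union>(F n)) < e"
    using null e by (auto dest: order_tendstoD)
  then obtain n where "emeasure M (A - \<Union>(F n)) < e" using eventually_happens'[OF sequentially_bot] by blast
  then show thesis using that[OF fin sub] by simp
qed

lemma emeasure_density_greaterThanLessThan:
  fixes m :: "real \<Rightarrow> ennreal"
  assumes [measurable]: "m \<in> borel_measurable borel"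
  shows "emeasure (density lborel m) {a<..<b} = emeasure (density lborel m) {a..b}"
proof -
  have "AE x in lborel. m x * indicator {a<..<b} x = m x * indicator {a..b} x"
    using AE_lborel_singleton[of a] AE_lborel_singleton[of b]
    by eventually_elim (auto simp: indicator_def)
  then show ?thesis by (simp add: emeasure_density nn_integral_cong_AE)
qed

text \<open>
  Almost every point is an endpoint of arbitrarily short segments across which the curve moves
  by at most the integral of its lower speed, up to a small multiple of the length. Finitely many
  disjoint ones leave gaps of small \<^term>\<open>m\<close>-measure.
\<close>

lemma dist_le_integral_lower_speed:
  fixes m :: "real \<Rightarrow> ennreal" and v :: "real \<Rightarrow> 'a::metric_space"
  assumes cont: "continuous_on UNIV v"
    and m [measurable]: "m \<in> borel_measurable borel" and fin: "(\<integral>\<^sup>+x. m x \<partial>lborel) < \<infinity>"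
    and le: "\<And>s t. s \<le> t \<Longrightarrow> ennreal (dist (v s) (v t)) \<le> emeasure (density lborel m) {s..t}"
    and st: "s \<le> t"
  shows "ennreal (dist (v s) (v t)) \<le> emeasure (density lborel (lower_speed v)) {s..t}"
proof (rule ennreal_le_epsilon)
  fix e :: real assume e: "e > 0"
  let ?N = "lower_speed v" and ?\<mu> = "density lborel m" and ?\<nu> = "density lborel (lower_speed v)"
  have N [measurable]: "?N \<in> borel_measurable borel" by (rule borel_measurable_lower_speed[OF cont])
  have N_le: "AE x in lborel. ?N x \<le> m x" by (rule lower_speed_AE_le[OF m fin le])
  then have "(\<integral>\<^sup>+x. ?N x \<partial>lborel) \<le> (\<integral>\<^sup>+x. m x \<partial>lborel)" by (rule nn_integral_mono_AE)
  then have N_fin: "(\<integral>\<^sup>+x. ?N x \<partial>lborel) < \<infinity>" using fin by order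
  \<comment> \<open>Chosen so that the length errors sum to at most \<open>e / 2\<close>; the
    summand 1 keeps the denominator positive when \<open>s = t\<close>.\<close>
  define \<eta> where "\<eta> = e / (4 * (t - s + 1))"
  have \<eta>: "\<eta> > 0" "2 * \<eta> * (t - s) \<le> e / 2"
    using e st by (auto simp: \<eta>_def field_simps)
  \<comment> \<open>The covering lemma passes on only the set, so the endpoints are recovered as
    \<open>Inf\<close> and \<open>Sup\<close>.\<close>
  define P where "P I \<longleftrightarrow> ennreal (dist (v (Inf I)) (v (Sup I))) \<le> emeasure ?\<nu> I + ennreal (2 * \<eta>) * emeasure lborel I"
    for I :: "real set"
  define S where "S = {x \<in> {s<..<t}. \<exists>\<^sub>F y in at x. P (closed_segment x y)}"
  have "AE x in lborel. ?N x \<noteq> \<infinity>"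
    using N N_fin by (intro nn_integral_PInf_AE) auto
  with AE_lower_density[OF N N_fin] have "AE x in lborel. x \<in> {s<..<t} \<longrightarrow> x \<in> S"
  proof eventually_elim
    case (elim x)
    then have "\<exists>\<^sub>F y in at x. ennreal (dist (v x) (v y)) \<le>
      emeasure ?\<nu> (closed_segment x y) + ennreal (2 * \<eta>) * ennreal \<bar>y - x\<bar>"
      by (intro frequently_dist_le_lower_speed \<eta>) (auto simp: less_top)
    then have "\<exists>\<^sub>F y in at x. P (closed_segment x y)"
      by (rule frequently_elim1)
        (auto simp: P_def emeasure_lborel_closed_segment closed_segment_eq_real_ivl dist_commute split: if_splits)
    then show ?case by (simp add: S_def)
  qed
  \<comment> \<open>No measurability of \<open>S\<close> has been established, so its null
    complement in the interval is handled in the completed measure.\<close>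
  then have "AE x in lebesgue. x \<notin> {s<..<t} - S"
    by (subst AE_completion_iff) (auto elim: eventually_mono)
  then obtain Z where Z: "{x \<in> space lebesgue. \<not> x \<notin> {s<..<t} - S} \<subseteq> Z" "Z \<in> null_sets lebesgue"
    by (auto simp: eventually_ae_filter)
  then have "negligible Z" "{s<..<t} - S \<subseteq> Z" by (auto simp: negligible_iff_null_sets)
  then have neg: "negligible ({s<..<t} - S)" by (rule negligible_subset)
  have S: "S \<subseteq> {s<..<t}" "\<And>x. x \<in> S \<Longrightarrow> \<exists>\<^sub>F y in at x. P (closed_segment x y)"
    by (auto simp: S_def)
  obtain \<C> where \<C>: "countable \<C>" "disjoint \<C>"
    "\<forall>I\<in>\<C>. P I \<and> I \<subseteq> {s<..<t} \<and> (\<exists>a b. a < b \<and> I = {a..b})" "negligible (S - \<Union>\<C>)"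
    by (rule Vitali_covering_segments[OF open_greaterThanLessThan S])
  have \<C>b: "\<C> \<subseteq> sets borel" using \<C>(3) by fastforce
  have [measurable]: "\<Union>\<C> \<in> sets borel" using \<C>(1) \<C>b by (rule sets.countable_Union)
  have "negligible ({s<..<t} - \<Union>\<C>)"
    by (rule negligible_subset[OF negligible_Un[OF neg \<C>(4)]]) auto
  then have "emeasure lborel ({s<..<t} - \<Union>\<C>) = 0"
    by (subst (asm) negligible_iff_emeasure0) auto
  then have "{s<..<t} - \<Union>\<C> \<in> null_sets lborel" by (auto intro!: null_setsI)
  \<comment> \<open>Absolute continuity carries the null remainder over to the measure with density
    \<open>m\<close>, in which the gaps have to be small.\<close>
  then have "{s<..<t} - \<Union>\<C> \<in> null_sets ?\<mu>"
    using absolutely_continuousI_density[of m lborel] by (auto simp: absolutely_continuous_def)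
  then have "emeasure ?\<mu> ({s<..<t} - \<Union>\<C>) = 0" by auto
  moreover have "emeasure ?\<mu> {s<..<t} < \<infinity>"
    using emeasure_mono[of "{s<..<t}" UNIV ?\<mu>] fin by (auto simp: emeasure_density intro: le_less_trans)
  ultimately obtain \<F> where \<F>: "finite \<F>" "\<F> \<subseteq> \<C>" "emeasure ?\<mu> ({s<..<t} - \<Union>\<F>) < ennreal (e / 2)"
    using countable_Union_finite_remainder[of \<C> ?\<mu> "{s<..<t}" "ennreal (e / 2)"] \<C>(1) \<C>b e by auto
  have \<F>b: "\<F> \<subseteq> sets borel" using \<F>(2) \<C>b by blast
  have disj: "disjoint \<F>" using \<C>(2) \<F>(2) by (rule pairwise_subset)
  have disj': "disjoint_family_on (\<lambda>I. I) \<F>"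
    using disj by (auto simp: disjoint_def disjoint_family_on_def)
  have "\<Union>\<F> \<subseteq> {s<..<t}" using \<F>(2) \<C>(3) by blast
  then have sub: "\<Union>\<F> \<subseteq> {s..t}" by (rule order.trans) auto
  \<comment> \<open>Across the gaps only the a priori bound by \<open>m\<close> is available; on the
    chosen intervals it is replaced by the lower speed.\<close>
  have "ennreal (dist (v s) (v t)) \<le> 
    (\<Sum>I\<in>\<F>. ennreal (dist (v (Inf I)) (v (Sup I)))) + emeasure ?\<mu> ({s<..<t} - \<Union>\<F>)"
  proof (rule dist_le_sum_plus_gaps[OF m _ \<F>(1) disj st])
    show "I \<subseteq> {s..t} \<and> (\<exists>a b. a < b \<and> I = {a..b})" if "I \<in> \<F>" for I
      using sub \<C>(3)[rule_format, of I] \<F>(2) that by blast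
  qed (use le emeasure_density_greaterThanLessThan[OF m] in auto)
  also have "\<dots> \<le> (\<Sum>I\<in>\<F>. emeasure ?\<nu> I + ennreal (2 * \<eta>) * emeasure lborel I) + ennreal (e / 2)"
    using \<F> \<C>(3) by (intro add_mono sum_mono less_imp_le[OF \<F>(3)]) (auto simp: P_def)
  also have "(\<Sum>I\<in>\<F>. emeasure ?\<nu> I + ennreal (2 * \<eta>) * emeasure lborel I) =
      emeasure ?\<nu> (\<Union>\<F>) + ennreal (2 * \<eta>) * emeasure lborel (\<Union>\<F>)"
    using sum_emeasure[of "\<lambda>I. I" \<F> ?\<nu>] sum_emeasure[of "\<lambda>I. I" \<F> lborel] \<F>b disj' \<F>(1)
    by (simp add: sum.distrib sum_distrib_left[symmetric])
  also have "\<dots> \<le> emeasure ?\<nu> {s..t} + ennreal (2 * \<eta>) * emeasure lborel {s..t}"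
    using sub by (intro add_mono mult_left_mono emeasure_mono) auto
  also have "ennreal (2 * \<eta>) * emeasure lborel {s..t} = ennreal (2 * \<eta> * (t - s))"
    using st \<eta>(1) by (simp add: ennreal_mult)
  also have "\<dots> \<le> ennreal (e / 2)" using \<eta>(2) by (rule ennreal_leI)
  also have "emeasure ?\<nu> {s..t} + ennreal (e / 2) + ennreal (e / 2) = emeasure ?\<nu> {s..t} + ennreal e"
    using e by (simp add: add.assoc ennreal_plus[symmetric] del: ennreal_plus)
  finally show "ennreal (dist (v s) (v t)) \<le> emeasure ?\<nu> {s..t} + ennreal e"
    by (simp add: add_mono)
qed

text \<open>The lower speed is now itself an admissible majorant, so almost everywhere the limsup of
  the quotients is at most their liminf. Hence the limit exists, and it is finite because the lower
  speed is integrable.\<close>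

theorem metric_derivative_lower_speed:
  fixes m :: "real \<Rightarrow> ennreal" and v :: "real \<Rightarrow> 'a::metric_space"
  assumes cont: "continuous_on UNIV v"
    and m [measurable]: "m \<in> borel_measurable borel" and fin: "(\<integral>\<^sup>+x. m x \<partial>lborel) < \<infinity>"
    and le: "\<And>s t. s \<le> t \<Longrightarrow> ennreal (dist (v s) (v t)) \<le> emeasure (density lborel m) {s..t}"
  shows "AE x in lborel. lower_speed v x = ennreal (metric_derivative v x)"
proof -
  let ?N = "lower_speed v"
  have N [measurable]: "?N \<in> borel_measurable borel" by (rule borel_measurable_lower_speed[OF cont])
  have N_le: "AE x in lborel. ?N x \<le> m x" by (rule lower_speed_AE_le[OF m fin le])
  then have "(\<integral>\<^sup>+x. ?N x \<partial>lborel) \<le> (\<integral>\<^sup>+x. m x \<partial>lborel)" by (rule nn_integral_mono_AE)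
  then have N_fin: "(\<integral>\<^sup>+x. ?N x \<partial>lborel) < \<infinity>" using fin by order
  have "AE x in lborel. ?N x \<noteq> \<infinity>"
    using N N_fin by (intro nn_integral_PInf_AE) auto
  moreover have "AE x in lborel. \<forall>q::real. ?N x < q \<longrightarrow> (\<forall>\<^sub>F y in at x. dist (v y) (v x) / \<bar>y - x\<bar> \<le> q)"
    by (rule AE_difference_quotient_le[OF N N_fin dist_le_integral_lower_speed[OF cont m fin le]])
  ultimately show ?thesis
  proof eventually_elim
    case (elim x)
    then obtain n where n: "?N x = ennreal n" "n \<ge> 0" by (cases "?N x") auto
    have "((\<lambda>y. dist (v y) (v x) / \<bar>y - x\<bar>) \<longlongrightarrow> n) (at x)"
    proof (rule order_tendstoI)
      fix a assume a: "a < n"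
      show "\<forall>\<^sub>F y in at x. a < dist (v y) (v x) / \<bar>y - x\<bar>"
      proof (cases "a < 0")
        case True
        then show ?thesis by (intro always_eventually allI) (auto intro: less_le_trans)
      next
        case False
        then have "ennreal a < ?N x" using a n by (simp add: ennreal_less_iff)
        from less_lower_speedD[OF this] show ?thesis
          by eventually_elim (use False in \<open>simp add: ennreal_less_iff\<close>)
      qed
    next
      fix a assume a: "n < a"
      then obtain q where q: "n < q" "q < a" using dense by blast
      then have "?N x < ennreal q" using n by (simp add: ennreal_less_iff)
      then have "\<forall>\<^sub>F y in at x. dist (v y) (v x) / \<bar>y - x\<bar> \<le> q" using elim by blast
      then show "\<forall>\<^sub>F y in at x. dist (v y) (v x) / \<bar>y - x\<bar> < a"
        by eventually_elim (use q in simp)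
    qed
    then have "((\<lambda>h. dist (v (x + h)) (v x) / \<bar>h\<bar>) \<longlongrightarrow> n) (at 0)"
      by (subst (asm) LIM_offset_zero_iff) auto
    then have "metric_derivative v x = n"
      unfolding metric_derivative_def by (intro tendsto_Lim) auto
    then show ?case using n by simp
  qed
qed

section \<open>Curves on compact intervals of positive times\<close>

text \<open>The measure with density \<open>m\<close> on \<open>{a..b}\<close> is finite and has no
  atoms, so intervals shrinking to a point have mass tending to 0. It serves for the curve and, with
  real values, for the energy along it.\<close>

lemma continuous_on_if_dist_le_integral:
  fixes m :: "real \<Rightarrow> ennreal" and v :: "real \<Rightarrow> 'a::metric_space"
  assumes [measurable]: "m \<in> borel_measurable borel" and fin: "(\<integral>\<^sup>+x\<in>{a..b}. m x \<partial>lborel) < \<infinity>"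
    and le: "\<And>s t. a \<le> s \<Longrightarrow> s \<le> t \<Longrightarrow> t \<le> b \<Longrightarrow> ennreal (dist (v s) (v t)) \<le> (\<integral>\<^sup>+x\<in>{s..t}. m x \<partial>lborel)"
  shows "continuous_on {a..b} v"
proof -
  define \<mu> where "\<mu> = density lborel (\<lambda>x. m x * indicator {a..b} x)"
  have \<mu>: "ennreal (dist (v s) (v t)) \<le> emeasure \<mu> A"
    if "s \<in> {a..b}" "t \<in> {a..b}" "closed_segment s t \<subseteq> A" and [measurable]: "A \<in> sets borel" for s t A
  proof -
    have "closed_segment s t \<subseteq> A \<inter> {a..b}"
      using that closed_segment_subset[of s "{a..b}" t] by auto
    then have "(\<integral>\<^sup>+x\<in>closed_segment s t. m x \<partial>lborel) \<le> emeasure \<mu> A"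
      by (auto simp: \<mu>_def emeasure_density indicator_def subset_iff intro!: nn_integral_mono)
    moreover have "ennreal (dist (v s) (v t)) \<le> (\<integral>\<^sup>+x\<in>closed_segment s t. m x \<partial>lborel)"
      using le[of s t] le[of t s] that by (auto simp: closed_segment_eq_real_ivl dist_commute)
    ultimately show ?thesis by order
  qed
  show ?thesis
    unfolding continuous_on_iff
  proof (intro ballI allI impI)
    fix x e :: real assume x: "x \<in> {a..b}" and e: "e > 0"
    have "(\<lambda>n. emeasure \<mu> {x - 1 / Suc n..x + 1 / Suc n}) \<longlonglongrightarrow> emeasure \<mu> (\<Inter>n. {x - 1 / Suc n..x + 1 / Suc n})"
    proof (rule Lim_emeasure_decseq)
      show "range (\<lambda>n. {x - 1 / Suc n..x + 1 / Suc n}) \<subseteq> sets \<mu>" by (auto simp: \<mu>_def)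
      show "decseq (\<lambda>n. {x - 1 / Suc n..x + 1 / Suc n})"
      proof (rule decseq_SucI)
        fix n
        have "1 / real (Suc (Suc n)) \<le> 1 / real (Suc n)" by (simp add: field_simps)
        then show "{x - 1 / Suc (Suc n)..x + 1 / Suc (Suc n)} \<subseteq> {x - 1 / Suc n..x + 1 / Suc n}"
          unfolding atLeastatMost_subset_iff by linarith
      qed
      have "emeasure \<mu> UNIV < \<infinity>" using fin by (simp add: \<mu>_def emeasure_density)
      then show "emeasure \<mu> {x - 1 / Suc n..x + 1 / Suc n} \<noteq> \<infinity>" for n
        using emeasure_mono[of "{x - 1 / Suc n..x + 1 / Suc n}" UNIV \<mu>] by (auto simp: \<mu>_def top_unique)
    qed
    also have "(\<Inter>n. {x - 1 / Suc n..x + 1 / Suc n}) = {x}"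
    proof -
      have "y = x" if y: "\<forall>n. x - 1 / real (Suc n) \<le> y \<and> y \<le> x + 1 / real (Suc n)" for y
      proof (rule ccontr)
        assume "y \<noteq> x"
        then obtain n where "1 / real (Suc n) < \<bar>y - x\<bar>"
          using nat_approx_posE[of "\<bar>y - x\<bar>"] by auto
        with y[rule_format, of n] show False by linarith
      qed
      then show ?thesis by auto
    qed
    also have "emeasure \<mu> {x} = 0"
      using AE_lborel_singleton[of x]
      by (auto simp: \<mu>_def emeasure_density nn_integral_0_iff_AE indicator_def elim!: eventually_mono)
    finally have "\<forall>\<^sub>F n in sequentially. emeasure \<mu> {x - 1 / Suc n..x + 1 / Suc n} < ennreal e"
      using e by (intro order_tendstoD) auto
    then obtain n where n: "emeasure \<mu> {x - 1 / Suc n..x + 1 / Suc n} < ennreal e"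
      using eventually_happens'[OF sequentially_bot] by blast
    show "\<exists>d>0. \<forall>x'\<in>{a..b}. dist x' x < d \<longrightarrow> dist (v x') (v x) < e"
    proof (intro exI[of _ "1 / Suc n"] conjI ballI impI)
      fix y assume y: "y \<in> {a..b}" "dist y x < 1 / Suc n"
      have "0 \<le> 1 / real (Suc n)" by simp
      then have "closed_segment y x \<subseteq> {x - 1 / Suc n..x + 1 / Suc n}"
        using y(2) by (auto simp: closed_segment_eq_real_ivl dist_real_def)
      with \<mu>[OF y(1) x this] n have "ennreal (dist (v y) (v x)) < ennreal e" by (simp add: le_less_trans)
      then show "dist (v y) (v x) < e" by (simp add: ennreal_less_iff)
    qed simp
  qed
qed

text \<open>Only the germ at \<open>t\<close> enters. Where the limit fails to exist both sides are
  still the same unspecified value, because the two limit predicates agree.\<close>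

lemma metric_derivative_cong:
  assumes "\<forall>\<^sub>F s in nhds t. v s = w s"
  shows "metric_derivative v t = metric_derivative w t"
proof -
  have "v t = w t" using assms by (rule eventually_nhds_x_imp_x)
  have "\<forall>\<^sub>F s in at t. v s = w s" using assms by (simp add: eventually_nhds_conv_at)
  then have "\<forall>\<^sub>F h in at 0. v (h + t) = w (h + t)" by (subst (asm) at_to_0) (simp add: eventually_filtermap)
  then have "\<forall>\<^sub>F h in at 0. dist (v (t + h)) (v t) / \<bar>h\<bar> = dist (w (t + h)) (w t) / \<bar>h\<bar>"
    by eventually_elim (simp add: \<open>v t = w t\<close> add.commute)
  from tendsto_cong[OF this] show ?thesis by (simp add: metric_derivative_def Topological_Spaces.Lim_def)
qed

text \<open>Freezing the curve at its end values outside \<open>{a..b}\<close> reduces the claim to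
  curves on the whole line. \<open>N\<close> is a Borel representative of the metric derivative,
  which by itself is not shown to be measurable.\<close>

theorem metric_derivative_interval:
  fixes m :: "real \<Rightarrow> ennreal" and v :: "real \<Rightarrow> 'a::metric_space"
  assumes [measurable]: "m \<in> borel_measurable borel" and fin: "(\<integral>\<^sup>+x\<in>{a..b}. m x \<partial>lborel) < \<infinity>"
    and "a \<le> b"
    and le: "\<And>s t. a \<le> s \<Longrightarrow> s \<le> t \<Longrightarrow> t \<le> b \<Longrightarrow> ennreal (dist (v s) (v t)) \<le> (\<integral>\<^sup>+x\<in>{s..t}. m x \<partial>lborel)"
  obtains N where "N \<in> borel_measurable borel"
    "AE x in lborel. x \<in> {a..b} \<longrightarrow> ennreal (metric_derivative v x) = N x"
    "\<forall>s t. a \<le> s \<longrightarrow> s \<le> t \<longrightarrow> t \<le> b \<longrightarrow> ennreal (dist (v s) (v t)) \<le> (\<integral>\<^sup>+x\<in>{s..t}. N x \<partial>lborel)"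
proof -
  define w where "w t = v (max a (min b t))" for t
  define M where "M x = m x * indicator {a..b} x" for x
  have w_eq: "w t = v t" if "t \<in> {a..b}" for t using that by (simp add: w_def)
  have M [measurable]: "M \<in> borel_measurable borel" unfolding M_def[abs_def] by measurable
  have M_fin: "(\<integral>\<^sup>+x. M x \<partial>lborel) < \<infinity>" using fin by (simp add: M_def)
  have "continuous_on {a..b} v" by (rule continuous_on_if_dist_le_integral[OF assms(1,2) le])
  then have cont: "continuous_on UNIV w"
    unfolding w_def[abs_def]
    by (rule continuous_on_compose2) (use \<open>a \<le> b\<close> in \<open>auto intro!: continuous_intros\<close>)
  have w_le: "ennreal (dist (w s) (w t)) \<le> emeasure (density lborel M) {s..t}" if "s \<le> t" for s t
  proof (cases "s \<le> b \<and> a \<le> t")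
    case True
    have "ennreal (dist (w s) (w t)) \<le> (\<integral>\<^sup>+x\<in>{max a (min b s)..max a (min b t)}. m x \<partial>lborel)"
      unfolding w_def using that \<open>a \<le> b\<close> by (intro le) auto
    also have "\<dots> \<le> emeasure (density lborel M) {s..t}"
      using True \<open>a \<le> b\<close> by (auto simp: emeasure_density M_def indicator_def intro!: nn_integral_mono)
    finally show ?thesis .
  next
    case False
    then have "w s = w t" using that by (auto simp: w_def)
    then show ?thesis by simp
  qed
  have "AE x in lborel. lower_speed w x = ennreal (metric_derivative w x)"
    by (rule metric_derivative_lower_speed[OF cont M M_fin w_le])
  \<comment> \<open>At the two endpoints the germs of \<open>v\<close> and \<open>w\<close> may
    differ, so these points are discarded.\<close>
  then have "AE x in lborel. x \<in> {a..b} \<longrightarrow> ennreal (metric_derivative v x) = lower_speed w x"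
    using AE_lborel_singleton[of a] AE_lborel_singleton[of b]
  proof eventually_elim
    case (elim x)
    show ?case
    proof
      assume "x \<in> {a..b}"
      then have "x \<in> {a<..<b}" using elim by auto
      then have "\<forall>\<^sub>F s in nhds x. s \<in> {a<..<b}" by (intro eventually_nhds_in_open) auto
      then have "\<forall>\<^sub>F s in nhds x. v s = w s" by eventually_elim (simp add: w_eq)
      then show "ennreal (metric_derivative v x) = lower_speed w x"
        using elim by (simp add: metric_derivative_cong[of v w])
    qed
  qed
  then show thesis
  proof (rule that[OF borel_measurable_lower_speed[OF cont]], intro allI impI)
    fix s t assume "a \<le> s" "s \<le> t" "t \<le> b"
    then show "ennreal (dist (v s) (v t)) \<le> (\<integral>\<^sup>+x\<in>{s..t}. lower_speed w x \<partial>lborel)"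
      using dist_le_integral_lower_speed[OF cont M M_fin w_le, of s t] borel_measurable_lower_speed[OF cont]
      by (simp add: w_eq emeasure_density)
  qed
qed

text \<open>Passage from the Lebesgue integrals of the definition to nonnegative extended integrals
  on one compact interval.\<close>

lemma loc_abs_continuous_curve_nn_integral:
  assumes "loc_abs_continuous_curve v" "0 < a"
  obtains m :: "real \<Rightarrow> ennreal" where "m \<in> borel_measurable borel" "(\<integral>\<^sup>+x\<in>{a..b}. m x \<partial>lborel) < \<infinity>"
    "\<forall>s t. a \<le> s \<longrightarrow> s \<le> t \<longrightarrow> t \<le> b \<longrightarrow> ennreal (dist (v s) (v t)) \<le> (\<integral>\<^sup>+x\<in>{s..t}. m x \<partial>lborel)"
proof -
  obtain m :: "real \<Rightarrow> real" where m: "\<And>r. r > 0 \<Longrightarrow> 0 \<le> m r"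
    "\<And>s t. 0 < s \<Longrightarrow> s \<le> t \<Longrightarrow> set_integrable lborel {s..t} m"
    "\<And>s t. 0 < s \<Longrightarrow> s \<le> t \<Longrightarrow> dist (v t) (v s) \<le> (LINT r:{s..t}|lborel. m r)"
    using assms(1) unfolding loc_abs_continuous_curve_def by blast
  \<comment> \<open>Integrability, and with it measurability, is given only on compact intervals of
    positive times; truncation yields a Borel function on the whole line.\<close>
  define M where "M x = ennreal (indicator {a..b} x *\<^sub>R m x)" for x
  have int: "integrable lborel (\<lambda>x. indicator {a..b} x *\<^sub>R m x)"
  proof (cases "a \<le> b")
    case True then show ?thesis using m(2)[OF assms(2)] by (simp add: set_integrable_def)
  qed auto
  then have [measurable]: "M \<in> borel_measurable borel" by (auto simp: M_def[abs_def])
  have nn: "(\<integral>\<^sup>+x\<in>{s..t}. M x \<partial>lborel) = ennreal (LINT r:{s..t}|lborel. m r)"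
    if st: "a \<le> s" "s \<le> t" "t \<le> b" for s t
  proof -
    have "(\<integral>\<^sup>+x\<in>{s..t}. M x \<partial>lborel) = (\<integral>\<^sup>+x. ennreal (indicator {s..t} x *\<^sub>R m x) \<partial>lborel)"
      using st by (intro nn_integral_cong) (auto simp: M_def indicator_def)
    also have "\<dots> = ennreal (LINT r:{s..t}|lborel. m r)"
      unfolding set_lebesgue_integral_def
      using st assms(2) m(1) m(2)[of s t]
      by (intro nn_integral_eq_integral) (auto simp: set_integrable_def indicator_def)
    finally show ?thesis .
  qed
  show thesis
  proof (rule that[of M])
    show "(\<integral>\<^sup>+x\<in>{a..b}. M x \<partial>lborel) < \<infinity>"
      using nn[of a b] by (cases "a \<le> b") auto
    show "\<forall>s t. a \<le> s \<longrightarrow> s \<le> t \<longrightarrow> t \<le> b \<longrightarrow>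
        ennreal (dist (v s) (v t)) \<le> (\<integral>\<^sup>+x\<in>{s..t}. M x \<partial>lborel)"
    proof (intro allI impI)
      fix s t assume "a \<le> s" "s \<le> t" "t \<le> b"
      then show "ennreal (dist (v s) (v t)) \<le> (\<integral>\<^sup>+x\<in>{s..t}. M x \<partial>lborel)"
        using m(3)[of s t] assms(2) by (simp add: nn dist_commute ennreal_leI)
    qed
  qed simp
qed

lemma loc_abs_continuous_curve_imp_continuous_on:
  assumes "loc_abs_continuous_curve v"
  shows "continuous_on {0<..} v"
proof -
  have "isCont v t" if t: "t > 0" for t
  proof -
    have "0 < t/2" using t by simp
    then obtain m :: "real \<Rightarrow> ennreal" where m: "m \<in> borel_measurable borel" "(\<integral>\<^sup>+x\<in>{t/2..2*t}. m x \<partial>lborel) < \<infinity>"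
      "\<forall>r s. t/2 \<le> r \<longrightarrow> r \<le> s \<longrightarrow> s \<le> 2*t \<longrightarrow> ennreal (dist (v r) (v s)) \<le> (\<integral>\<^sup>+x\<in>{r..s}. m x \<partial>lborel)"
      by (rule loc_abs_continuous_curve_nn_integral[OF assms])
    then have "continuous_on {t/2..2*t} v"
      by (intro continuous_on_if_dist_le_integral[OF m(1,2) m(3)[rule_format]])
    then show ?thesis using t by (rule_tac continuous_on_interior) (auto simp: interior_atLeastAtMost_real)
  qed
  then show ?thesis by (simp add: continuous_at_imp_continuous_on)
qed

section \<open>Gradient flows\<close>

text \<open>All later estimates draw on this list: \<open>N\<close> and \<open>K\<close> are Borel
  functions representing the metric derivative and \<open>g\<close> along \<open>v\<close>, and the
  extended real inequalities of the definitions become inequalities for the real energy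
  \<open>\<phi>\<close>.\<close>

lemma gradient_flow_interval:
  fixes \<Phi> :: "'a::metric_space \<Rightarrow> ereal" and v :: "real \<Rightarrow> 'a"
  assumes \<Phi>: "\<forall>x. \<Phi> x \<noteq> - \<infinity>" and ug: "upper_gradient \<Phi> g" and flow: "gradient_flow \<Phi> g v"
    and a: "0 < a"
  defines "\<phi> \<equiv> \<lambda>t. real_of_ereal (\<Phi> (v t))"
  obtains N K :: "real \<Rightarrow> ennreal" where "N \<in> borel_measurable borel" "K \<in> borel_measurable borel"
    "AE r in lborel. r \<in> {a..b} \<longrightarrow> ennreal (metric_derivative v r) = N r"
    "\<forall>r\<in>{a..b}. K r = e2ennreal (g (v r))"
    "\<forall>s t. a \<le> s \<longrightarrow> s \<le> t \<longrightarrow> t \<le> b \<longrightarrow> ennreal (dist (v s) (v t)) \<le> (\<integral>\<^sup>+r\<in>{s..t}. N r \<partial>lborel)"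
    "\<forall>s t. a \<le> s \<longrightarrow> s \<le> t \<longrightarrow> t \<le> b \<longrightarrow> \<phi> t \<le> \<phi> s"
    "\<forall>s t. a \<le> s \<longrightarrow> s \<le> t \<longrightarrow> t \<le> b \<longrightarrow>
      (\<integral>\<^sup>+r\<in>{s..t}. (N r)\<^sup>2 + (K r)\<^sup>2 \<partial>lborel) \<le> ennreal (2 * (\<phi> s - \<phi> t))"
    "\<forall>s t. a \<le> s \<longrightarrow> s \<le> t \<longrightarrow> t \<le> b \<longrightarrow>
      ennreal (dist (\<phi> s) (\<phi> t)) \<le> (\<integral>\<^sup>+r\<in>{s..t}. K r * N r \<partial>lborel)"
proof (cases "a \<le> b")
  case False
  have "\<not> (a \<le> s \<and> s \<le> t \<and> t \<le> b)" for s t using False by auto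
  then show thesis using False by (intro that[of "\<lambda>_. 0" "\<lambda>_. 0"]) auto
next
  case True
  have ac: "loc_abs_continuous_curve v" and dom: "\<forall>t>0. v t \<in> effective_domain \<Phi>"
    and energy: "\<And>s t. 0 < s \<Longrightarrow> 0 < t \<Longrightarrow> \<Phi> (v t) - \<Phi> (v s) \<le>
          - (ereal (1/2) * oriented_nn_integral s t (\<lambda>r. (ennreal (metric_derivative v r))\<^sup>2))
          - ereal (1/2) * oriented_nn_integral s t (\<lambda>r. (e2ennreal (g (v r)))\<^sup>2)"
    using flow unfolding gradient_flow_def by blast+
  have \<phi>: "\<Phi> (v t) = ereal (\<phi> t)" if "t > 0" for t
    using dom \<Phi> that by (auto simp: \<phi>_def effective_domain_def ereal_real)
  have g_meas: "(\<lambda>r. g (v r)) \<in> borel_measurable (restrict_space borel {0<..})"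
    and ug': "\<And>s t. 0 < s \<Longrightarrow> s \<le> t \<Longrightarrow> \<bar>\<Phi> (v t) - \<Phi> (v s)\<bar> \<le>
               enn2ereal (\<integral>\<^sup>+r\<in>{s..t}. (e2ennreal (g (v r)) * ennreal (metric_derivative v r)) \<partial>lborel)"
    using ug ac dom unfolding upper_gradient_def by blast+
  obtain m :: "real \<Rightarrow> ennreal" where m: "m \<in> borel_measurable borel" "(\<integral>\<^sup>+x\<in>{a..b}. m x \<partial>lborel) < \<infinity>"
    "\<forall>s t. a \<le> s \<longrightarrow> s \<le> t \<longrightarrow> t \<le> b \<longrightarrow> ennreal (dist (v s) (v t)) \<le> (\<integral>\<^sup>+x\<in>{s..t}. m x \<partial>lborel)"
    by (rule loc_abs_continuous_curve_nn_integral[OF ac a])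
  obtain N where N [measurable]: "N \<in> borel_measurable borel"
    and N_eq: "AE x in lborel. x \<in> {a..b} \<longrightarrow> ennreal (metric_derivative v x) = N x"
    and N_le: "\<forall>s t. a \<le> s \<longrightarrow> s \<le> t \<longrightarrow> t \<le> b \<longrightarrow> ennreal (dist (v s) (v t)) \<le> (\<integral>\<^sup>+x\<in>{s..t}. N x \<partial>lborel)"
    by (rule metric_derivative_interval[OF m(1,2) True m(3)[rule_format]])
  \<comment> \<open>Along the curve \<open>g\<close> is Borel only on the positive half-line, so it
    is extended by 0.\<close>
  define K where "K r = e2ennreal (g (v r)) * indicator {0<..} r" for r
  have "(\<lambda>r. e2ennreal (g (v r))) \<in> borel_measurable (restrict_space borel {0<..})"
    using g_meas by measurable
  then have K [measurable]: "K \<in> borel_measurable borel"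
    unfolding K_def[abs_def] by (subst (asm) borel_measurable_restrict_space_iff_ennreal) auto
  have K_eq: "K r = e2ennreal (g (v r))" if "r \<in> {a..b}" for r
    using that a by (simp add: K_def)
  have upper: "ennreal (dist (\<phi> s) (\<phi> t)) \<le> (\<integral>\<^sup>+r\<in>{s..t}. K r * N r \<partial>lborel)"
    if st: "a \<le> s" "s \<le> t" "t \<le> b" for s t
  proof -
    have "(\<integral>\<^sup>+r\<in>{s..t}. (e2ennreal (g (v r)) * ennreal (metric_derivative v r)) \<partial>lborel) =
        (\<integral>\<^sup>+r\<in>{s..t}. K r * N r \<partial>lborel)"
      by (rule nn_integral_cong_AE) (use N_eq in \<open>eventually_elim, use K_eq st in \<open>auto simp: indicator_def\<close>\<close>)
    then have "\<bar>\<Phi> (v t) - \<Phi> (v s)\<bar> \<le> enn2ereal (\<integral>\<^sup>+r\<in>{s..t}. K r * N r \<partial>lborel)"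
      using ug'[of s t] st a by simp
    then have "ereal (dist (\<phi> s) (\<phi> t)) \<le> enn2ereal (\<integral>\<^sup>+r\<in>{s..t}. K r * N r \<partial>lborel)"
      using st a by (simp add: \<phi> dist_real_def abs_minus_commute)
    then show ?thesis
      using e2ennreal_mono by fastforce
  qed
  have en: "\<phi> t \<le> \<phi> s \<and> (\<integral>\<^sup>+r\<in>{s..t}. (N r)\<^sup>2 + (K r)\<^sup>2 \<partial>lborel) \<le> ennreal (2 * (\<phi> s - \<phi> t))"
    if st: "a \<le> s" "s \<le> t" "t \<le> b" for s t
  proof -
    define A B where "A = (\<integral>\<^sup>+r\<in>{s..t}. (N r)\<^sup>2 \<partial>lborel)" and "B = (\<integral>\<^sup>+r\<in>{s..t}. (K r)\<^sup>2 \<partial>lborel)"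
    have "(\<integral>\<^sup>+r\<in>{s..t}. (ennreal (metric_derivative v r))\<^sup>2 \<partial>lborel) = A"
      unfolding A_def
      by (rule nn_integral_cong_AE) (use N_eq in \<open>eventually_elim, use st in \<open>auto simp: indicator_def\<close>\<close>)
    moreover have "(\<integral>\<^sup>+r\<in>{s..t}. (e2ennreal (g (v r)))\<^sup>2 \<partial>lborel) = B"
      unfolding B_def by (rule nn_integral_cong) (use K_eq st in \<open>auto simp: indicator_def\<close>)
    ultimately have *: "ereal (\<phi> t - \<phi> s) \<le> - (ereal (1/2) * enn2ereal A) - ereal (1/2) * enn2ereal B"
      using energy[of s t] st a by (simp add: oriented_nn_integral_def \<phi>)
    \<comment> \<open>Both integrals are finite: otherwise the right-hand side would be minus
      infinity, while the left-hand side is real.\<close>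
    obtain x y where xy: "A = ennreal x" "x \<ge> 0" "B = ennreal y" "y \<ge> 0"
      using * by (cases A; cases B) (auto simp: enn2ereal_ennreal)
    have "\<phi> t - \<phi> s \<le> - (x / 2) - y / 2" using * xy by (simp add: enn2ereal_ennreal)
    then have le: "x + y \<le> 2 * (\<phi> s - \<phi> t)" by simp
    have "(\<integral>\<^sup>+r\<in>{s..t}. (N r)\<^sup>2 + (K r)\<^sup>2 \<partial>lborel) = A + B"
      unfolding A_def B_def by (subst nn_integral_add[symmetric]) (auto simp: distrib_right)
    also have "\<dots> \<le> ennreal (2 * (\<phi> s - \<phi> t))"
      using le xy by (simp add: ennreal_plus[symmetric] ennreal_leI del: ennreal_plus)
    finally show ?thesis using le xy by simp
  qed
  show thesis
    by (rule that[OF N K N_eq _ N_le]) (blast intro: K_eq upper en[THEN conjunct1] en[THEN conjunct2])+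
qed

lemma ennreal_two_mult_le_sum_squares: "2 * x * y \<le> x\<^sup>2 + y\<^sup>2" for x y :: ennreal
proof (cases x; cases y)
  fix p q :: real assume pq: "x = ennreal p" "y = ennreal q" "0 \<le> p" "0 \<le> q"
  have "2 * p * q \<le> p\<^sup>2 + q\<^sup>2" by (rule sum_squares_bound)
  then have "ennreal (2 * p * q) \<le> ennreal (p\<^sup>2 + q\<^sup>2)" by (rule ennreal_leI)
  then show ?thesis using pq by (simp add: ennreal_mult ennreal_power ennreal_mult'')
qed auto

text \<open>Where \<open>g \<ge> k\<close>, the integrand
  \<open>(N r)\<^sup>2 + (K r)\<^sup>2\<close> is at least \<open>2 * N r * k\<close> by Young's
  inequality, and at least \<open>k\<^sup>2\<close> by its second term alone. The first bound limits
  the distance travelled, the second the time spent.\<close>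

lemma gradient_flow_energy_drop:
  fixes \<Phi> :: "'a::metric_space \<Rightarrow> ereal" and v :: "real \<Rightarrow> 'a"
  assumes \<Phi>: "\<forall>x. \<Phi> x \<noteq> - \<infinity>" and ug: "upper_gradient \<Phi> g" and flow: "gradient_flow \<Phi> g v"
    and st: "0 < s" "s \<le> t" and k: "0 \<le> k" and ge: "\<And>r. r \<in> {s..t} \<Longrightarrow> ereal k \<le> g (v r)"
  defines "\<phi> \<equiv> \<lambda>t. real_of_ereal (\<Phi> (v t))"
  shows "k * dist (v s) (v t) \<le> \<phi> s - \<phi> t" "k\<^sup>2 * (t - s) \<le> 2 * (\<phi> s - \<phi> t)"
proof -
  obtain N K :: "real \<Rightarrow> ennreal" where N [measurable]: "N \<in> borel_measurable borel"
    and K [measurable]: "K \<in> borel_measurable borel"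
    and "AE r in lborel. r \<in> {s..t} \<longrightarrow> ennreal (metric_derivative v r) = N r"
    and K_eq: "\<forall>r\<in>{s..t}. K r = e2ennreal (g (v r))"
    and dist: "\<forall>s' t'. s \<le> s' \<longrightarrow> s' \<le> t' \<longrightarrow> t' \<le> t \<longrightarrow> ennreal (dist (v s') (v t')) \<le> (\<integral>\<^sup>+r\<in>{s'..t'}. N r \<partial>lborel)"
    and mono: "\<forall>s' t'. s \<le> s' \<longrightarrow> s' \<le> t' \<longrightarrow> t' \<le> t \<longrightarrow> \<phi> t' \<le> \<phi> s'"
    and energy: "\<forall>s' t'. s \<le> s' \<longrightarrow> s' \<le> t' \<longrightarrow> t' \<le> t \<longrightarrow>
      (\<integral>\<^sup>+r\<in>{s'..t'}. (N r)\<^sup>2 + (K r)\<^sup>2 \<partial>lborel) \<le> ennreal (2 * (\<phi> s' - \<phi> t'))"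
    and "\<forall>s' t'. s \<le> s' \<longrightarrow> s' \<le> t' \<longrightarrow> t' \<le> t \<longrightarrow>
      ennreal (dist (\<phi> s') (\<phi> t')) \<le> (\<integral>\<^sup>+r\<in>{s'..t'}. K r * N r \<partial>lborel)"
    unfolding \<phi>_def by (rule gradient_flow_interval[OF \<Phi> ug flow st(1)])
  \<comment> \<open>Monotonicity permits the removal of \<open>ennreal\<close> at the end, since a
    negative energy drop would be truncated to 0.\<close>
  have \<phi>: "\<phi> t \<le> \<phi> s" using mono st by simp
  have kK: "ennreal k \<le> K r" if "r \<in> {s..t}" for r
    using e2ennreal_mono[OF ge[OF that]] K_eq that by simp
  have "ennreal (2 * (k * dist (v s) (v t))) = ennreal (2 * k) * ennreal (dist (v s) (v t))"
    using k by (simp add: ennreal_mult[symmetric] mult.assoc)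
  also have "\<dots> \<le> ennreal (2 * k) * (\<integral>\<^sup>+r\<in>{s..t}. N r \<partial>lborel)"
    using dist st by (intro mult_left_mono) simp_all
  also have "\<dots> = (\<integral>\<^sup>+r\<in>{s..t}. 2 * N r * ennreal k \<partial>lborel)"
    using k by (subst nn_integral_cmult[symmetric]) (auto simp: ennreal_mult mult_ac)
  also have "\<dots> \<le> (\<integral>\<^sup>+r\<in>{s..t}. (N r)\<^sup>2 + (K r)\<^sup>2 \<partial>lborel)"
  proof (rule nn_integral_mono)
    fix r
    have "2 * N r * ennreal k \<le> (N r)\<^sup>2 + (K r)\<^sup>2" if "r \<in> {s..t}"
      by (rule order.trans[OF mult_left_mono[OF kK[OF that]] ennreal_two_mult_le_sum_squares]) simp
    then show "2 * N r * ennreal k * indicator {s..t} r \<le> ((N r)\<^sup>2 + (K r)\<^sup>2) * indicator {s..t} r"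
      by (auto simp: indicator_def)
  qed
  also have "\<dots> \<le> ennreal (2 * (\<phi> s - \<phi> t))" using energy st by simp
  finally show "k * dist (v s) (v t) \<le> \<phi> s - \<phi> t" using \<phi> by (subst (asm) ennreal_le_iff) auto
  have "ennreal (k\<^sup>2 * (t - s)) = (\<integral>\<^sup>+r\<in>{s..t}. ennreal (k\<^sup>2) \<partial>lborel)"
    using st by (simp add: nn_integral_cmult_indicator ennreal_mult)
  also have "\<dots> \<le> (\<integral>\<^sup>+r\<in>{s..t}. (N r)\<^sup>2 + (K r)\<^sup>2 \<partial>lborel)"
  proof (rule nn_integral_mono)
    fix r
    have "ennreal (k\<^sup>2) \<le> (N r)\<^sup>2 + (K r)\<^sup>2" if "r \<in> {s..t}"
      using power_mono[OF kK[OF that], of 2] k by (simp add: ennreal_power add_increasing)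
    then show "ennreal (k\<^sup>2) * indicator {s..t} r \<le> ((N r)\<^sup>2 + (K r)\<^sup>2) * indicator {s..t} r"
      by (auto simp: indicator_def)
  qed
  also have "\<dots> \<le> ennreal (2 * (\<phi> s - \<phi> t))" using energy st by simp
  finally show "k\<^sup>2 * (t - s) \<le> 2 * (\<phi> s - \<phi> t)" using \<phi> by (subst (asm) ennreal_le_iff) auto
qed

lemma gradient_flow_antimono:
  fixes \<Phi> :: "'a::metric_space \<Rightarrow> ereal" and v :: "real \<Rightarrow> 'a"
  assumes "gradient_flow \<Phi> g v" "0 < s" "s \<le> t"
  shows "\<Phi> (v t) \<le> \<Phi> (v s)"
proof -
  have "\<Phi> (v t) - \<Phi> (v s) \<le> 
     - (ereal (1/2) * oriented_nn_integral s t (\<lambda>r. (ennreal (metric_derivative v r))\<^sup>2))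
          - ereal (1/2) * oriented_nn_integral s t (\<lambda>r. (e2ennreal (g (v r)))\<^sup>2)"
    using assms unfolding gradient_flow_def by auto
  also have "\<dots> \<le> 0 - 0"
    using assms(3) by (intro ereal_minus_mono) (auto simp: oriented_nn_integral_def)
  finally have "\<Phi> (v t) - \<Phi> (v s) \<le> 0" by simp
  then show ?thesis by (cases "\<Phi> (v t)"; cases "\<Phi> (v s)") auto
qed

text \<open>The upper gradient inequality bounds energy differences by integrals of
  \<open>K * N\<close>, and this product is dominated by the sum of squares, whose integral is
  finite by the energy inequality. Continuity is what lets the energy converge when a flow is
  restarted at a later time.\<close>

lemma gradient_flow_energy_continuous_on:
  fixes \<Phi> :: "'a::metric_space \<Rightarrow> ereal" and v :: "real \<Rightarrow> 'a"
  assumes \<Phi>: "\<forall>x. \<Phi> x \<noteq> - \<infinity>" and ug: "upper_gradient \<Phi> g" and flow: "gradient_flow \<Phi> g v"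
  shows "continuous_on {0<..} (\<lambda>t. \<Phi> (v t))"
proof -
  define \<phi> where "\<phi> t = real_of_ereal (\<Phi> (v t))" for t
  have "isCont \<phi> t" if t: "t > 0" for t
  proof -
    have "0 < t/2" using t by simp
    then obtain N K :: "real \<Rightarrow> ennreal" where N [measurable]: "N \<in> borel_measurable borel"
      and K [measurable]: "K \<in> borel_measurable borel"
      and "AE r in lborel. r \<in> {t/2..2*t} \<longrightarrow> ennreal (metric_derivative v r) = N r"
      and "\<forall>r\<in>{t/2..2*t}. K r = e2ennreal (g (v r))"
      and "\<forall>r s. t/2 \<le> r \<longrightarrow> r \<le> s \<longrightarrow> s \<le> 2*t \<longrightarrow> ennreal (dist (v r) (v s)) \<le> (\<integral>\<^sup>+x\<in>{r..s}. N x \<partial>lborel)"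
      and "\<forall>r s. t/2 \<le> r \<longrightarrow> r \<le> s \<longrightarrow> s \<le> 2*t \<longrightarrow> \<phi> s \<le> \<phi> r"
      and energy: "\<forall>r s. t/2 \<le> r \<longrightarrow> r \<le> s \<longrightarrow> s \<le> 2*t \<longrightarrow>
        (\<integral>\<^sup>+x\<in>{r..s}. (N x)\<^sup>2 + (K x)\<^sup>2 \<partial>lborel) \<le> ennreal (2 * (\<phi> r - \<phi> s))"
      and upper: "\<forall>r s. t/2 \<le> r \<longrightarrow> r \<le> s \<longrightarrow> s \<le> 2*t \<longrightarrow>
        ennreal (dist (\<phi> r) (\<phi> s)) \<le> (\<integral>\<^sup>+x\<in>{r..s}. K x * N x \<partial>lborel)"
      unfolding \<phi>_def by (rule gradient_flow_interval[OF \<Phi> ug flow])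
    have "(\<integral>\<^sup>+x\<in>{t/2..2*t}. K x * N x \<partial>lborel) \<le> (\<integral>\<^sup>+x\<in>{t/2..2*t}. (N x)\<^sup>2 + (K x)\<^sup>2 \<partial>lborel)"
    proof (rule nn_integral_mono)
      fix x
      have "1 * (N x * K x) \<le> 2 * (N x * K x)" by (rule mult_right_mono) auto
      then have "K x * N x \<le> 2 * N x * K x" by (simp add: mult_ac)
      also have "\<dots> \<le> (N x)\<^sup>2 + (K x)\<^sup>2" by (rule ennreal_two_mult_le_sum_squares)
      finally show "K x * N x * indicator {t/2..2*t} x \<le> ((N x)\<^sup>2 + (K x)\<^sup>2) * indicator {t/2..2*t} x"
        by (auto simp: indicator_def)
    qed
    also have "\<dots> < \<infinity>" using t by (intro le_less_trans[OF energy[rule_format, of "t/2" "2*t"]]) simp_all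
    finally have fin: "(\<integral>\<^sup>+x\<in>{t/2..2*t}. K x * N x \<partial>lborel) < \<infinity>" .
    have "continuous_on {t/2..2*t} \<phi>"
      by (rule continuous_on_if_dist_le_integral[OF _ fin upper[rule_format]]) measurable
    then show ?thesis using t by (rule_tac continuous_on_interior) (auto simp: interior_atLeastAtMost_real)
  qed
  then have "continuous_on {0<..} (\<lambda>t. ereal (\<phi> t))"
    by (intro continuous_on_ereal) (simp add: continuous_at_imp_continuous_on)
  moreover have "\<Phi> (v t) = ereal (\<phi> t)" if "t > 0" for t
    using flow \<Phi> that by (auto simp: \<phi>_def gradient_flow_def effective_domain_def ereal_real)
  ultimately show ?thesis
    by (subst continuous_on_cong[OF refl, of _ _ "\<lambda>t. ereal (\<phi> t)"]) auto
qed

text \<open>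
  The function \<^term>\<open>h\<close> itself need not be measurable, so the library's translation rule
  does not apply to it directly.
\<close>

lemma set_nn_integral_translate:
  fixes h N :: "real \<Rightarrow> ennreal"
  assumes [measurable]: "N \<in> borel_measurable borel"
    and AE: "AE r in lborel. r \<in> {T + s..T + t} \<longrightarrow> h r = N r"
  shows "(\<integral>\<^sup>+r\<in>{s..t}. h (T + r) \<partial>lborel) = (\<integral>\<^sup>+r\<in>{T + s..T + t}. h r \<partial>lborel)"
proof -
  obtain Z where Z: "{r \<in> space lborel. \<not> (r \<in> {T + s..T + t} \<longrightarrow> h r = N r)} \<subseteq> Z" "Z \<in> null_sets lborel"
    using AE unfolding eventually_ae_filter by (elim bexE)
  have eq: "h r = N r" if "r \<notin> Z" "r \<in> {T + s..T + t}" for r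
    using Z(1) that by auto
  have [measurable]: "Z \<in> sets borel" using Z(2) by auto
  have "AE r in lborel. T + 1 * r \<notin> Z"
    by (rule AE_borel_affine) (use AE_not_in[OF Z(2)] in auto)
  then have "AE r in lborel. h (T + r) * indicator {s..t} r = N (T + 1 * r) * indicator {T + s..T + t} (T + 1 * r)"
    by eventually_elim (use eq in \<open>auto simp: indicator_def\<close>)
  then have "(\<integral>\<^sup>+r\<in>{s..t}. h (T + r) \<partial>lborel) = (\<integral>\<^sup>+r. N (T + 1 * r) * indicator {T + s..T + t} (T + 1 * r) \<partial>lborel)"
    by (rule nn_integral_cong_AE)
  also have "\<dots> = (\<integral>\<^sup>+r\<in>{T + s..T + t}. N r \<partial>lborel)"
    by (subst nn_integral_real_affine[where c=1 and t=T, of "\<lambda>r. N r * indicator {T + s..T + t} r"]) auto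
  also have "\<dots> = (\<integral>\<^sup>+r\<in>{T + s..T + t}. h r \<partial>lborel)"
    by (rule nn_integral_cong_AE) (use AE in \<open>eventually_elim, auto simp: indicator_def\<close>)
  finally show ?thesis .
qed

section \<open>Restarting a flow at a later time\<close>

lemma loc_abs_continuous_curve_shift:
  assumes "loc_abs_continuous_curve v" "0 < T"
  shows "loc_abs_continuous_curve (\<lambda>t. v (T + t))"
proof -
  obtain m :: "real \<Rightarrow> real" where m: "\<And>r. r > 0 \<Longrightarrow> 0 \<le> m r"
    "\<And>s t. 0 < s \<Longrightarrow> s \<le> t \<Longrightarrow> set_integrable lborel {s..t} m"
    "\<And>s t. 0 < s \<Longrightarrow> s \<le> t \<Longrightarrow> dist (v t) (v s) \<le> (LINT r:{s..t}|lborel. m r)"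
    using assms(1) unfolding loc_abs_continuous_curve_def by blast
  have shift: "(LINT r:{T + s..T + t}|lborel. m r) = (LINT r:{s..t}|lborel. m (T + r))" for s t
    unfolding set_lebesgue_integral_def
    by (subst lborel_integral_real_affine[where c=1 and t=T]) (simp_all add: indicator_def)
  show ?thesis
    unfolding loc_abs_continuous_curve_def
  proof (intro exI[of _ "\<lambda>r. m (T + r)"] conjI allI impI)
    fix s t :: real assume st: "0 < s \<and> s \<le> t"
    show "set_integrable lborel {s..t} (\<lambda>r. m (T + r))"
      using lborel_integrable_real_affine[where c=1 and t=T, OF m(2)[of "T + s" "T + t", unfolded set_integrable_def]]
        st assms(2) by (simp add: set_integrable_def indicator_def)
    show "dist (v (T + t)) (v (T + s)) \<le> (LINT r:{s..t}|lborel. m (T + r))"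
      using m(3)[of "T + s" "T + t"] st assms(2) by (simp add: shift)
  qed (use m(1) assms(2) in simp)
qed

text \<open>The energy inequality is autonomous. The translation of its integrals goes through the
  Borel representatives \<open>N\<close> and \<open>K\<close>, as the integrands themselves may fail
  to be measurable.\<close>

lemma gradient_flow_shift:
  fixes \<Phi> :: "'a::metric_space \<Rightarrow> ereal" and v :: "real \<Rightarrow> 'a"
  assumes \<Phi>: "\<forall>x. \<Phi> x \<noteq> - \<infinity>" and ug: "upper_gradient \<Phi> g" and flow: "gradient_flow \<Phi> g v"
    and T: "0 < T"
  shows "gradient_flow \<Phi> g (\<lambda>t. v (T + t))"
proof -
  \<comment> \<open>An identity at every time, including those without a limit, because the
    difference quotients coincide literally.\<close>
  have md: "metric_derivative (\<lambda>t. v (T + t)) r = metric_derivative v (T + r)" for r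
    by (simp add: metric_derivative_def add.assoc)
  have integrals: "(\<integral>\<^sup>+r\<in>{s..t}. (ennreal (metric_derivative v (T + r)))\<^sup>2 \<partial>lborel) =
      (\<integral>\<^sup>+r\<in>{T + s..T + t}. (ennreal (metric_derivative v r))\<^sup>2 \<partial>lborel) \<and>
      (\<integral>\<^sup>+r\<in>{s..t}. (e2ennreal (g (v (T + r))))\<^sup>2 \<partial>lborel) =
      (\<integral>\<^sup>+r\<in>{T + s..T + t}. (e2ennreal (g (v r)))\<^sup>2 \<partial>lborel)" if "0 < s" for s t
  proof -
    have "0 < T + s" using that T by simp
    then obtain N K :: "real \<Rightarrow> ennreal" where [measurable]: "N \<in> borel_measurable borel" "K \<in> borel_measurable borel"
      and N: "AE r in lborel. r \<in> {T + s..T + t} \<longrightarrow> ennreal (metric_derivative v r) = N r"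
      and K: "\<forall>r\<in>{T + s..T + t}. K r = e2ennreal (g (v r))"
      by (rule gradient_flow_interval[OF \<Phi> ug flow])
    show ?thesis
    proof
      show "(\<integral>\<^sup>+r\<in>{s..t}. (ennreal (metric_derivative v (T + r)))\<^sup>2 \<partial>lborel) =
          (\<integral>\<^sup>+r\<in>{T + s..T + t}. (ennreal (metric_derivative v r))\<^sup>2 \<partial>lborel)"
        by (rule set_nn_integral_translate[of "\<lambda>r. (N r)\<^sup>2"]) (use N in \<open>auto elim: eventually_mono\<close>)
      show "(\<integral>\<^sup>+r\<in>{s..t}. (e2ennreal (g (v (T + r))))\<^sup>2 \<partial>lborel) =
          (\<integral>\<^sup>+r\<in>{T + s..T + t}. (e2ennreal (g (v r)))\<^sup>2 \<partial>lborel)"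
        by (rule set_nn_integral_translate[of "\<lambda>r. (K r)\<^sup>2"]) (simp_all add: K)
    qed
  qed
  \<comment> \<open>The reversed orientation integrates over \<open>{t..s}\<close>, so the
    translation is also used with \<open>s\<close> and \<open>t\<close> exchanged.\<close>
  have oriented: "oriented_nn_integral s t (\<lambda>r. (ennreal (metric_derivative v (T + r)))\<^sup>2) =
      oriented_nn_integral (T + s) (T + t) (\<lambda>r. (ennreal (metric_derivative v r))\<^sup>2)"
    "oriented_nn_integral s t (\<lambda>r. (e2ennreal (g (v (T + r))))\<^sup>2) =
      oriented_nn_integral (T + s) (T + t) (\<lambda>r. (e2ennreal (g (v r)))\<^sup>2)" if "0 < s" "0 < t" for s t
    unfolding oriented_nn_integral_def
    using integrals[OF that(1), of t] integrals[OF that(2), of s] by (simp_all only: add_le_cancel_left)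
  show ?thesis
    unfolding gradient_flow_def md
  proof (intro conjI allI impI)
    show "loc_abs_continuous_curve (\<lambda>t. v (T + t))"
      using flow T loc_abs_continuous_curve_shift unfolding gradient_flow_def by blast
    show "v (T + t) \<in> effective_domain \<Phi>" if "t > 0" for t
      using flow T that unfolding gradient_flow_def by simp
    fix s t :: real assume st: "0 < s" "0 < t"
    show "\<Phi> (v (T + t)) - \<Phi> (v (T + s)) \<le>
      - (ereal (1/2) * oriented_nn_integral s t (\<lambda>r. (ennreal (metric_derivative v (T + r)))\<^sup>2))
          - ereal (1/2) * oriented_nn_integral s t (\<lambda>r. (e2ennreal (g (v (T + r))))\<^sup>2)"
      unfolding oriented[OF st] using flow st T unfolding gradient_flow_def by simp
  qed
qed

lemma continuous_on_tendsto_shift: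
  fixes f :: "real \<Rightarrow> 'b::topological_space"
  assumes "continuous_on {0<..} f" "0 < T"
  shows "((\<lambda>t. f (T + t)) \<longlongrightarrow> f T) (at_right 0)"
proof -
  have "isCont f T" using assms by (simp add: continuous_on_eq_continuous_at)
  moreover have "((\<lambda>t. T + t) \<longlongrightarrow> T) (at_right 0)" by (auto intro!: tendsto_eq_intros)
  ultimately show ?thesis by (rule isCont_tendsto_compose)
qed

text \<open>The flow restarted at \<open>T\<close> is the witness; continuity of the curve and of
  the energy along it give the two initial limits.\<close>

lemma gradient_flow_in_flow_initial_points:
  fixes \<Phi> :: "'a::metric_space \<Rightarrow> ereal" and v :: "real \<Rightarrow> 'a"
  assumes \<Phi>: "\<forall>x. \<Phi> x \<noteq> - \<infinity>" and ug: "upper_gradient \<Phi> g" and flow: "gradient_flow \<Phi> g v"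
    and T: "0 < T"
  shows "v T \<in> flow_initial_points \<Phi> g"
proof -
  have "v T \<in> effective_domain \<Phi>" "loc_abs_continuous_curve v"
    using flow T unfolding gradient_flow_def by auto
  then show ?thesis
    unfolding flow_initial_points_def
    using gradient_flow_shift[OF assms] 
      continuous_on_tendsto_shift[OF loc_abs_continuous_curve_imp_continuous_on T]
      continuous_on_tendsto_shift[OF gradient_flow_energy_continuous_on[OF \<Phi> ug flow] T]
    by blast
qed

section \<open>Minimizers and strict bounds on the local slope\<close>

lemma local_slope_minimizer:
  assumes "\<forall>x. \<Phi> x \<noteq> - \<infinity>" "\<Phi> w < \<infinity>" "\<And>y. \<Phi> w \<le> \<Phi> y"
  shows "local_slope \<Phi> w = 0"
proof -
  have "(\<Phi> w - \<Phi> y) / ereal (dist w y) \<le> 0" if "y \<noteq> w" for y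
    using assms(1)[rule_format, of w] assms(2) assms(3)[of y] that
    by (cases "\<Phi> w"; cases "\<Phi> y") (auto simp: divide_nonpos_pos)
  then have "\<forall>\<^sub>F y in at w. (\<Phi> w - \<Phi> y) / ereal (dist w y) \<le> 0"
    by (auto simp: eventually_at_filter)
  then have "Limsup (at w) (\<lambda>y. (\<Phi> w - \<Phi> y) / ereal (dist w y)) \<le> 0"
    by (rule Limsup_bounded)
  then show ?thesis using assms(2) by (simp add: local_slope_def effective_domain_def)
qed

text \<open>A strict bound on the limsup holds for the quotients themselves near \<open>w\<close>,
  and multiplication by the positive distance gives the inequality. Finiteness of the slope also
  places \<open>w\<close> in the effective domain.\<close>

lemma local_slope_lessD:
  assumes "\<forall>x. \<Phi> x \<noteq> - \<infinity>" "local_slope \<Phi> w < ereal k"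
  obtains V where "open V" "w \<in> V" "\<And>y. y \<in> V - {w} \<Longrightarrow> \<Phi> w < \<Phi> y + ereal (k * dist y w)"
proof -
  have w: "\<Phi> w < \<infinity>" and L: "Limsup (at w) (\<lambda>y. (\<Phi> w - \<Phi> y) / ereal (dist w y)) < ereal k"
    using assms(2) by (auto simp: local_slope_def effective_domain_def split: if_splits)
  have "\<forall>\<^sub>F y in at w. (\<Phi> w - \<Phi> y) / ereal (dist w y) < ereal k" by (rule Limsup_lessD[OF L])
  then obtain V where V: "open V" "w \<in> V" "\<And>y. y \<in> V \<Longrightarrow> y \<noteq> w \<Longrightarrow> (\<Phi> w - \<Phi> y) / ereal (dist w y) < ereal k"
    unfolding eventually_at_topological by blast
  have "\<Phi> w < \<Phi> y + ereal (k * dist y w)" if "y \<in> V - {w}" for y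
    using V(3)[of y] that assms(1)[rule_format, of w] assms(1)[rule_format, of y] w
    by (cases "\<Phi> w"; cases "\<Phi> y") (auto simp: divide_less_eq dist_commute)
  with V show thesis using that by blast
qed

section \<open>The exit time argument\<close>

theorem corollary2p9:
  fixes \<Phi> :: "'a::metric_space \<Rightarrow> ereal"
    and u :: 'a
    and \<epsilon> lam :: real
  assumes "\<forall>x. \<Phi> x \<noteq> - \<infinity>"
    and "effective_domain \<Phi> \<noteq> {}"
    and "\<exists>c::real. \<forall>x. ereal c \<le> \<Phi> x"
    and "upper_gradient \<Phi> (local_slope \<Phi>)"
    and "flow_initial_points \<Phi> (local_slope \<Phi>) \<noteq> {}"
    and "u \<in> flow_initial_points \<Phi> (local_slope \<Phi>)"
    and "\<epsilon> > 0"
    and "\<Phi> u \<le> (INF x. \<Phi> x) + ereal \<epsilon>"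
    and "lam > 0"
  shows "\<exists>u'\<in>flow_initial_points \<Phi> (local_slope \<Phi>). \<exists>V. u' \<in> interior V \<and>
           dist u u' \<le> lam \<and>
           \<Phi> u' \<le> \<Phi> u \<and>
           (\<forall>v\<in>V - {u'}. \<Phi> u' < \<Phi> v + ereal (\<epsilon> / lam * dist v u'))"
proof -
  obtain v where flow: "gradient_flow \<Phi> (local_slope \<Phi>) v" and v_lim: "(v \<longlongrightarrow> u) (at_right 0)"
    and \<Phi>_lim: "((\<lambda>t. \<Phi> (v t)) \<longlongrightarrow> \<Phi> u) (at_right 0)" and u: "u \<in> effective_domain \<Phi>"
    using assms(6) unfolding flow_initial_points_def by blast
  obtain c where c: "\<And>x. ereal c \<le> \<Phi> x" using assms(3) by blast
  define k where "k = \<epsilon> / lam"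
  have k: "k > 0" "k * lam = \<epsilon>" using assms(7,9) by (auto simp: k_def)
  define p where "p = real_of_ereal (\<Phi> u)"
  define \<phi> where "\<phi> t = real_of_ereal (\<Phi> (v t))" for t
  have p: "\<Phi> u = ereal p"
    using u assms(1) by (auto simp: p_def effective_domain_def ereal_real)
  have \<phi>: "\<Phi> (v t) = ereal (\<phi> t)" if "t > 0" for t
    using flow assms(1) that by (auto simp: \<phi>_def gradient_flow_def effective_domain_def ereal_real)
  have cont: "continuous_on {0<..} v"
    using flow loc_abs_continuous_curve_imp_continuous_on unfolding gradient_flow_def by blast
  have pos: "\<forall>\<^sub>F t in at_right (0::real). 0 < t" by (simp add: eventually_at_right_less)
  have "\<forall>\<^sub>F t in at_right 0. \<Phi> (v t) = ereal (\<phi> t)"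
    using pos by eventually_elim (rule \<phi>)
  then have \<phi>_lim: "(\<phi> \<longlongrightarrow> p) (at_right 0)"
    using \<Phi>_lim unfolding p by (simp add: tendsto_cong)
  \<comment> \<open>Near minimality of \<open>u\<close> in real terms: no finite value of \<Phi>
    lies below \<open>p - \<epsilon>\<close>.\<close>
  have inf: "p - \<epsilon> \<le> a" if "\<Phi> y = ereal a" for a y
  proof -
    have "\<Phi> u \<le> \<Phi> y + ereal \<epsilon>"
      by (rule order.trans[OF assms(8)]) (intro add_right_mono INF_lower UNIV_I)
    then show ?thesis using that p by simp
  qed
  have \<phi>_le: "\<phi> t \<le> p" if t: "t > 0" for t
  proof (rule tendsto_lowerbound[OF \<phi>_lim])
    have "\<forall>\<^sub>F s in at_right 0. s < t" by (rule eventually_at_rightI[of 0 t]) (use t in auto)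
    with pos show "\<forall>\<^sub>F s in at_right 0. \<phi> t \<le> \<phi> s"
    proof eventually_elim
      case (elim s)
      then show ?case using gradient_flow_antimono[OF flow, of s t] t by (simp add: \<phi>)
    qed
  qed simp
  have dist_lim: "((\<lambda>t. dist u (v t)) \<longlongrightarrow> 0) (at_right 0)"
    using tendsto_dist[OF tendsto_const[of u] v_lim] by simp
  have "\<exists>t>0. dist u (v t) \<le> lam \<and> local_slope \<Phi> (v t) < ereal k"
  proof (rule ccontr)
    assume "\<not> ?thesis"
    then have slope: "ereal k \<le> local_slope \<Phi> (v t)" if "t > 0" "dist u (v t) \<le> lam" for t
      using that by (auto simp: not_less)
    have drop: "k * dist (v s) (v t) \<le> \<phi> s - \<phi> t" "k\<^sup>2 * (t - s) \<le> 2 * (\<phi> s - \<phi> t)"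
      if "0 < s" "s \<le> t" "\<And>r. r \<in> {s..t} \<Longrightarrow> dist u (v r) \<le> lam" for s t
      unfolding \<phi>_def
      by (rule gradient_flow_energy_drop[OF assms(1,4) flow]; use that k slope in auto)+
    show False
    proof (cases "\<forall>t>0. dist u (v t) \<le> lam")
      case True
      \<comment> \<open>Chosen so that \<open>k\<^sup>2 * (t - 1)\<close> exceeds twice the largest
        drop \<open>\<phi> 1 - c\<close> that the lower bound \<open>c\<close> permits. Counting
        starts at time 1 because the flow lives on positive times only.\<close>
      define t where "t = 1 + (2 * (\<phi> 1 - c) + 1) / k\<^sup>2"
      have lower: "c \<le> \<phi> t" if "t > 0" for t using c[of "v t"] \<phi>[OF that] by simp
      have "(2 * (\<phi> 1 - c) + 1) / k\<^sup>2 \<ge> 0" using lower[of 1] by simp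
      then have "t \<ge> 1" by (simp add: t_def)
      then have "k\<^sup>2 * (t - 1) \<le> 2 * (\<phi> 1 - \<phi> t)" using True by (intro drop) auto
      moreover have "k\<^sup>2 * (t - 1) = 2 * (\<phi> 1 - c) + 1" using k by (simp add: t_def)
      ultimately show False using lower[of t] \<open>t \<ge> 1\<close> by simp
    next
      case False
      then obtain t1 where t1: "t1 > 0" "lam < dist u (v t1)" by (auto simp: not_le)
      have "\<forall>\<^sub>F t in at_right 0. dist u (v t) < lam"
        using order_tendstoD(2)[OF dist_lim assms(9)] .
      then obtain b where b: "b > 0" "\<And>t. 0 < t \<Longrightarrow> t < b \<Longrightarrow> dist u (v t) < lam"
        unfolding eventually_at_right_field by auto
      have "b \<le> t1" using b(2)[of t1] t1 by linarith
      \<comment> \<open>Times outside the open ball. Starting at \<open>b/2\<close> keeps the set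
        compact within the positive times, and nothing is lost since the curve stays in the ball
        before \<open>b\<close>.\<close>
      define S where "S = {t \<in> {b/2..t1}. lam \<le> dist u (v t)}"
      have "continuous_on {b/2..t1} (\<lambda>t. dist u (v t))"
        using b(1) by (intro continuous_on_dist continuous_on_const continuous_on_subset[OF cont]) auto
      then have "closed S" unfolding S_def
        by (intro continuous_on_closed_Collect_le continuous_on_const) auto
      moreover have "bounded S" by (rule bounded_subset[of "{b/2..t1}"]) (auto simp: S_def)
      moreover have "t1 \<in> S" using t1 b(1) \<open>b \<le> t1\<close> by (auto simp: S_def)
      ultimately obtain T where T: "T \<in> S" "\<And>t. t \<in> S \<Longrightarrow> T \<le> t"
        using compact_attains_inf[of S] by (auto simp: compact_eq_bounded_closed)
      have T0: "T > 0" using T(1) b(1) by (simp add: S_def)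
      have before: "dist u (v r) < lam" if "0 < r" "r < T" for r
      proof (cases "r < b")
        case True
        then show ?thesis using b(2) that by blast
      next
        case False
        then have "r \<in> {b/2..t1}" using that b(1) T(1) by (auto simp: S_def)
        then show ?thesis using T(2)[of r] that by (force simp: S_def)
      qed
      \<comment> \<open>The limit from the left puts \<open>v T\<close> in the closed ball;
        membership of \<open>T\<close> in \<open>S\<close> gives the opposite bound, so the distance
        is exactly \<open>lam\<close>.\<close>
      have "isCont v T" using cont T0 by (simp add: continuous_on_eq_continuous_at)
      then have "((\<lambda>t. dist u (v t)) \<longlongrightarrow> dist u (v T)) (at_left T)"
        by (intro tendsto_dist tendsto_const) (auto simp: isCont_def filterlim_at_split)
      moreover have "\<forall>\<^sub>F t in at_left T. dist u (v t) \<le> lam"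
        using before T0 by (intro eventually_at_leftI[of 0]) (auto intro: less_imp_le)
      ultimately have "dist u (v T) \<le> lam" by (rule tendsto_upperbound) simp
      then have T_eq: "dist u (v T) = lam" using T(1) by (auto simp: S_def)
      have inside: "dist u (v r) \<le> lam" if "0 < r" "r \<le> T" for r
        using before[OF that(1)] T_eq that(2) by (cases "r = T") auto
      \<comment> \<open>The energy drop is known only from positive starting times; letting
        \<open>s\<close> tend to 0 replaces the start by \<open>u\<close> itself.\<close>
      have lim1: "((\<lambda>s. k * dist (v s) (v T)) \<longlongrightarrow> k * dist u (v T)) (at_right 0)"
        by (intro tendsto_intros v_lim)
      have lim2: "((\<lambda>s. \<phi> s - \<phi> T) \<longlongrightarrow> p - \<phi> T) (at_right 0)"
        by (intro tendsto_intros \<phi>_lim)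
      have "\<forall>\<^sub>F s in at_right 0. k * dist (v s) (v T) \<le> \<phi> s - \<phi> T"
        using T0 inside by (intro eventually_at_rightI[of 0 T] drop) auto
      then have "k * dist u (v T) \<le> p - \<phi> T"
        by (rule tendsto_le[OF _ lim2 lim1, rotated]) simp
      \<comment> \<open>The distance \<open>lam\<close> costs exactly
        \<open>k * lam = \<epsilon>\<close> of energy, all that near minimality leaves. Hence
        \<open>v T\<close> is a minimizer and its slope vanishes, against the assumed bound by
        \<open>k\<close>.\<close>
      then have "\<phi> T \<le> p - \<epsilon>" using k(2) T_eq by simp
      then have "\<Phi> (v T) \<le> \<Phi> y" for y
        using inf[of y] \<phi>[OF T0] assms(1)[rule_format, of y] by (cases "\<Phi> y") fastforce+
      then have "local_slope \<Phi> (v T) = 0"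
        using \<phi>[OF T0] by (intro local_slope_minimizer assms(1)) auto
      then show False using slope[OF T0] T_eq k(1) by simp
    qed
  qed
  then obtain t where t: "t > 0" "dist u (v t) \<le> lam" "local_slope \<Phi> (v t) < ereal k" by blast
  obtain V where V: "open V" "v t \<in> V" "\<And>y. y \<in> V - {v t} \<Longrightarrow> \<Phi> (v t) < \<Phi> y + ereal (k * dist y (v t))"
    using local_slope_lessD[OF assms(1) t(3)] by blast
  show ?thesis
  proof (intro bexI[of _ "v t"] exI[of _ V] conjI ballI)
    show "v t \<in> flow_initial_points \<Phi> (local_slope \<Phi>)"
      by (rule gradient_flow_in_flow_initial_points[OF assms(1,4) flow t(1)])
    show "v t \<in> interior V" using V by (simp add: interior_open)
    show "\<Phi> (v t) \<le> \<Phi> u" using \<phi>_le[OF t(1)] \<phi>[OF t(1)] p by simp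
  qed (use t V(3) in \<open>auto simp: k_def\<close>)
qed

end
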